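(* Let $(W,W')$ be an exchangeable pair of integer-valued random variables with $\mathbb{E}W=\mu$ and $0<\operatorname{Var}W=\sigma^2<\infty$. Assume that there are a number $0<\lambda<1$ and a random variable $R$ such that $$\mathbb{E}^W(W'-\mu)=(1-\lambda)(W-\mu)+R ,$$ and that $W'-W\in\{-1,0,+1\}$. Then, with $S=S(W)=\mathbb{P}[W'=W+1\mid W]$ and $q_{\max}=\max_{k\in\mathbb{Z}}\mathbb{P}[W=k]$, $$d_{\mathrm{TV}}(\mathscr{L}(W),\mathrm{TP}(\mu,\sigma^2))\le \frac{\sqrt{\operatorname{Var}S}}{\lambda\sigma^2}+\frac{2\sqrt{\operatorname{Var}R}}{\lambda\sigma}+\frac{2}{\sigma^2},$$ $$d_{\mathrm{loc}}(\mathscr{L}(W),\mathrm{TP}(\mu,\sigma^2))\le \frac{2\sqrt{q_{\max}\operatorname{Var}S}}{\lambda\sigma^2}+\frac{2q_{\max}\sqrt{\operatorname{Var}R}}{\lambda\sigma}+\frac{\sqrt{\operatorname{Var}R}}{\lambda\sigma^2}+\frac{2}{\sigma^2}.$$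
   Context: $\mathscr{L}(X)$ denotes the law of $X$. A pair $(W,W')$ is exchangeable if $\mathscr{L}(W,W')=\mathscr{L}(W',W)$. $\mathbb{E}^W$ denotes conditional expectation given $W$. Translated Poisson distribution: for $\mu\in\mathbb{R}$, $\sigma^2>0$, an integer-valued random variable $Y$ has law $\mathrm{TP}(\mu,\sigma^2)$ if $\mathscr{L}(Y-\mu+\sigma^2+\gamma)=\mathrm{Po}(\sigma^2+\gamma)$, where $\gamma=\langle\mu-\sigma^2\rangle$, $\langle x\rangle=x-\lfloor x\rfloor$ is the fractional part, and $\mathrm{Po}(\nu)$ is the Poisson distribution with mean $\nu$. For probability distributions $P,Q$ on $\mathbb{Z}$ with point probabilities $p_k,q_k$: $d_{\mathrm{TV}}(P,Q)=\sup_{A\subset\mathbb{Z}}|P(A)-Q(A)|$ and $d_{\mathrm{loc}}(P,Q)=\sup_{k\in\mathbb{Z}}|p_k-q_k|$. *)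

theory Defs
  imports "HOL-Probability.Probability"
begin

definition law :: "'a measure \<Rightarrow> ('a \<Rightarrow> int) \<Rightarrow> int measure" where
  "law M X = distr M (count_space UNIV) X"

definition exchangeable :: "'a measure \<Rightarrow> ('a \<Rightarrow> int) \<Rightarrow> ('a \<Rightarrow> int) \<Rightarrow> bool" where
  "exchangeable M X Y \<longleftrightarrow>
     distr M (count_space UNIV \<Otimes>\<^sub>M count_space UNIV) (\<lambda>\<omega>. (X \<omega>, Y \<omega>)) =
     distr M (count_space UNIV \<Otimes>\<^sub>M count_space UNIV) (\<lambda>\<omega>. (Y \<omega>, X \<omega>))"

definition cond_exp_given :: "'a measure \<Rightarrow> ('a \<Rightarrow> int) \<Rightarrow> ('a \<Rightarrow> real) \<Rightarrow> 'a \<Rightarrow> real" where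
  "cond_exp_given M X Z = real_cond_exp M (vimage_algebra (space M) X (count_space UNIV)) Z"

definition cond_prob_given :: "'a measure \<Rightarrow> ('a \<Rightarrow> int) \<Rightarrow> ('a \<Rightarrow> bool) \<Rightarrow> 'a \<Rightarrow> real" where
  "cond_prob_given M X A = cond_exp_given M X (indicator {\<omega> \<in> space M. A \<omega>})"

definition is_TP :: "real \<Rightarrow> real \<Rightarrow> int pmf \<Rightarrow> bool" where
  "is_TP \<mu> v P \<longleftrightarrow>
     (let \<gamma> = frac (\<mu> - v) in
       map_pmf (\<lambda>y. real_of_int y - \<mu> + v + \<gamma>) P = map_pmf real (poisson_pmf (v + \<gamma>)))"

(* Meaningful for v > 0 only; existence and uniqueness are is_TP_iff below. *)
definition TP :: "real \<Rightarrow> real \<Rightarrow> int measure" where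
  "TP \<mu> v = measure_pmf (THE P. is_TP \<mu> v P)"

lemma is_TP_iff:
  "is_TP \<mu> v P \<longleftrightarrow>
     P = map_pmf (\<lambda>n. int n + \<lfloor>\<mu> - v\<rfloor>) (poisson_pmf (v + frac (\<mu> - v)))"
    (is "_ \<longleftrightarrow> P = ?Q")
proof -
  let ?f = "\<lambda>y. real_of_int y - \<mu> + v + frac (\<mu> - v)"
  have f: "?f = (\<lambda>y. real_of_int (y - \<lfloor>\<mu> - v\<rfloor>))"
    by (auto simp: frac_def)
  have inj: "inj ?f"
    by (auto simp: inj_def)
  have "map_pmf ?f ?Q = map_pmf real (poisson_pmf (v + frac (\<mu> - v)))"
    unfolding f by (simp add: pmf.map_comp o_def)
  hence "is_TP \<mu> v P \<longleftrightarrow> map_pmf ?f P = map_pmf ?f ?Q"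
    by (simp add: is_TP_def Let_def)
  also have "\<dots> \<longleftrightarrow> P = ?Q"
    using pmf.inj_map[OF inj] by (auto dest: injD)
  finally show ?thesis .
qed

lemma TP_eq:
  "TP \<mu> v =
     measure_pmf (map_pmf (\<lambda>n. int n + \<lfloor>\<mu> - v\<rfloor>) (poisson_pmf (v + frac (\<mu> - v))))"
  by (simp add: TP_def is_TP_iff)

definition d_TV :: "int measure \<Rightarrow> int measure \<Rightarrow> real" where
  "d_TV P Q = (SUP A. \<bar>measure P A - measure Q A\<bar>)"

definition d_loc :: "int measure \<Rightarrow> int measure \<Rightarrow> real" where
  "d_loc P Q = (SUP k. \<bar>measure P {k} - measure Q {k}\<bar>)"

(* The supremum is attained, see q_max_attained. *)
definition q_max :: "'a measure \<Rightarrow> ('a \<Rightarrow> int) \<Rightarrow> real" where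
  "q_max M X = (SUP k. measure M {\<omega> \<in> space M. X \<omega> = k})"

lemma q_max_attained:
  assumes "prob_space M" and X: "X \<in> measurable M (count_space UNIV)"
  shows "\<exists>k. q_max M X = measure M {\<omega> \<in> space M. X \<omega> = k}"
proof -
  interpret prob_space M by fact
  let ?p = "\<lambda>k. prob {\<omega> \<in> space M. X \<omega> = k}"
  have [measurable]: "{\<omega> \<in> space M. X \<omega> = k} \<in> events" for k
    using X by measurable
  have sum_le: "sum ?p F \<le> 1" if "finite F" for F
  proof -
    have "sum ?p F = prob (\<Union>k\<in>F. {\<omega> \<in> space M. X \<omega> = k})"
      using that by (intro finite_measure_finite_Union[symmetric]) (auto simp: disjoint_family_on_def)
    thus ?thesis by simp
  qed
  have fin: "finite {k. ?p k \<ge> c}" if "c > 0" for c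
  proof (rule ccontr)
    assume inf: "infinite {k. ?p k \<ge> c}"
    obtain n :: nat where n: "1 < real n * c"
      using reals_Archimedean3[of c] \<open>c > 0\<close> by blast
    obtain F where F: "F \<subseteq> {k. ?p k \<ge> c}" "finite F" "card F = n"
      using infinite_arbitrarily_large[OF inf, of n] by blast
    have "real n * c \<le> sum ?p F"
      using sum_bounded_below[of F c ?p] F by auto
    with n sum_le[OF F(2)] show False by linarith
  qed
  have "\<exists>k. ?p k > 0"
  proof (rule ccontr)
    assume "\<not> ?thesis"
    hence z: "?p k = 0" for k by (simp add: not_less measure_le_0_iff)
    have "(\<Union>k. {\<omega> \<in> space M. X \<omega> = k}) \<in> null_sets M"
      by (intro null_sets_UN) (auto simp: null_sets_def emeasure_eq_measure z)
    moreover have "(\<Union>k. {\<omega> \<in> space M. X \<omega> = k}) = space M" by auto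
    ultimately show False by (simp add: null_sets_def emeasure_space_1)
  qed
  then obtain k0 where k0: "?p k0 > 0" by blast
  let ?K = "{k. ?p k \<ge> ?p k0}"
  have K: "finite ?K" "k0 \<in> ?K" using fin[OF k0] by auto
  hence ne: "finite (?p ` ?K)" "?p ` ?K \<noteq> {}" by auto
  then obtain k1 where k1: "?p k1 = Max (?p ` ?K)"
    using Max_in[OF ne] by (metis (no_types, lifting) imageE)
  have "?p k \<le> ?p k1" for k
  proof (cases "k \<in> ?K")
    case True
    thus ?thesis unfolding k1 using ne by (intro Max_ge) auto
  next
    case False
    hence "?p k \<le> ?p k0" by simp
    also have "\<dots> \<le> ?p k1" unfolding k1 using ne K(2) by (intro Max_ge) auto
    finally show ?thesis .
  qed
  hence "q_max M X = ?p k1"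
    unfolding q_max_def by (intro cSup_eq_maximum) auto
  thus ?thesis by blast
qed

end

theory Submission
  imports Defs
begin

text \<open>
  The proof is Stein's method for the Poisson distribution, applied to the translated variable
  W - s with s = \<lfloor>\<mu> - \<sigma>^2\<rfloor>. Its mean is v = \<sigma>^2 + \<gamma>, where \<gamma> < 1 is the fractional part of
  \<mu> - \<sigma>^2, and TP(\<mu>, \<sigma>^2) is Po(v) moved by s. For a set B of naturals let g be the solution of
  v g(k + 1) - k g(k) = 1_B(k) - Po(v)(B) with g(0) = 0, continued by 0 to the negative integers,
  and let \<Delta> be its forward difference, both read at W - s. Taking expectations, the distance
  between the two laws on A = B + s is v E[\<Delta>] - E[(W - \<mu>) g], up to an error of at most
  P(W < s) \<le> 1/\<sigma>^2 (Chebyshev), because the equation is only solved at the naturals.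

  Exchangeability enters through one identity (\<open>expectation_increment\<close>): upward jumps seen from W
  are downward jumps seen from W', hence E[(W' - W) h(W)] = - E[S (h(W + 1) - h(W))]. Combined with the
  regression property it gives \<lambda> E[(W - \<mu>) g] = E[S \<Delta>] + E[R g], and for h(w) = w - \<mu> it gives
  \<lambda> \<sigma>^2 = E[S] + E[(W - \<mu>) R]. Eliminating E[S] (\<open>stein_identity\<close>),
  \<lambda> (\<sigma>^2 E[\<Delta>] - E[(W - \<mu>) g]) = E[(W - \<mu>) R] E[\<Delta>] - Cov(S, \<Delta>) - E[R g],
  and Cauchy-Schwarz bounds the three terms by the standard deviations of S and R. The remaining
  (v - \<sigma>^2) E[\<Delta>] = \<gamma> E[\<Delta>] is at most 1/\<sigma>^2 and supplies the other half of the term 2/\<sigma>^2.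

  What is left are bounds on g. For every B one has |\<Delta>| \<le> 1/v and |g| \<le> 1/sqrt v. For a
  singleton B the function g starts and ends at 0 and has a single upward jump, so that
  |g| \<le> 1/v and the sum of |\<Delta>| is at most 2/v; averaging over W then costs a factor q_max.
  The constant 1 in |g| \<le> 1/sqrt v is the delicate point. With F and T the probabilities of
  {..k} and {k<..} under Po(v), and p the point probability at k, it amounts to
  F T \<le> sqrt v p, which says that the conditional means of Po(v) on the two sides of a cut are at
  least one standard deviation apart (\<open>head_mult_tail_le\<close>). This is a property of log-concave
  distributions: each side has at most the spread of a geometric distribution with the same mean,
  and the law of total variance does the rest.
\<close>

section \<open>Heads and tails of the Poisson distribution\<close>

abbreviation pois :: "real \<Rightarrow> nat \<Rightarrow> real" where
  "pois v k \<equiv> pmf (poisson_pmf v) k"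

abbreviation pois_prob :: "real \<Rightarrow> nat set \<Rightarrow> real" where
  "pois_prob v \<equiv> measure_pmf.prob (poisson_pmf v)"

definition head :: "real \<Rightarrow> nat \<Rightarrow> real" where
  "head v k = pois_prob v {..k}"

definition tail :: "real \<Rightarrow> nat \<Rightarrow> real" where
  "tail v k = pois_prob v {k<..}"

lemma head_0: "head v 0 = pois v 0"
  by (simp add: head_def measure_pmf_single)

lemma head_Suc: "head v (Suc k) = head v k + pois v (Suc k)"
  by (simp add: head_def measure_measure_pmf_finite)

lemma head_add_tail: "head v k + tail v k = 1"
proof -
  have "tail v k = pois_prob v (space (poisson_pmf v) - {..k})"
    unfolding tail_def by (rule arg_cong[where f = "measure_pmf.prob _"]) auto
  also have "\<dots> = 1 - head v k"
    unfolding head_def by (rule measure_pmf.prob_compl) simp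
  finally show ?thesis by simp
qed

lemma tail_Suc: "tail v k = tail v (Suc k) + pois v (Suc k)"
  using head_add_tail[of v k] head_add_tail[of v "Suc k"] head_Suc[of v k] by linarith

text \<open>
  Comparison of two sequences that vanish at infinity by comparing their increments: the tail
  sums below are handled through closed forms and this lemma instead of through infinite series.
\<close>

lemma le_of_tail_increments:
  fixes A B :: "nat \<Rightarrow> real"
  assumes "A \<longlonglongrightarrow> 0" "B \<longlonglongrightarrow> 0"
    and step: "\<And>i. k \<le> i \<Longrightarrow> A i - A (Suc i) \<le> c * (B i - B (Suc i))"
  shows "A k \<le> c * B k"
proof -
  let ?D = "\<lambda>n. c * B (n + k) - A (n + k)"
  have "decseq ?D"
    by (rule decseq_SucI) (use step in \<open>force simp: algebra_simps\<close>)
  moreover have "?D \<longlonglongrightarrow> c * 0 - 0"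
    by (intro tendsto_intros LIMSEQ_ignore_initial_segment assms)
  ultimately have "0 \<le> ?D 0"
    using decseq_ge[of ?D "c * 0 - 0" 0] by simp
  thus ?thesis by simp
qed

lemma le_of_head_increments:
  fixes A B :: "nat \<Rightarrow> real"
  assumes "A 0 \<le> c * B 0"
    and "\<And>i. i < k \<Longrightarrow> A (Suc i) - A i \<le> c * (B (Suc i) - B i)"
  shows "A k \<le> c * B k"
  using assms(2)
proof (induction k)
  case (Suc k)
  have "A k \<le> c * B k" using Suc by simp
  with Suc.prems[of k] show ?case by (simp add: algebra_simps)
qed (use assms in simp)

text \<open>
  The law of total variance in disguise. In the application d = k - v, and v - x and v + y are the
  conditional means of Po(v) on {..k} and {k<..}, so that x + y is their distance; the weights y and x
  used in the proof are proportional to the probabilities of the two sides. The numbers a and b are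
  the distances of the two means from the midpoint of the cut, and a + b = x + y.
\<close>

lemma square_le_of_two_quadratics:
  fixes x y d v :: real
  assumes "0 < x" "0 < y" "0 \<le> d + x" "0 \<le> y - d - 1"
    and head: "v \<le> (d + 2 * x) * (d + x + 1)"
    and tail: "v \<le> (y - d - 1) * (2 * y - d)"
  shows "v \<le> (x + y)\<^sup>2"
proof -
  define a b s where "a = d + x + 1/2" and "b = y - d - 1/2" and "s = x + y"
  have ab: "0 \<le> a" "0 \<le> b" "s = a + b" using assms by (auto simp: a_def b_def s_def)
  have s: "0 < s" using assms by (simp add: s_def)
  have "s * v = y * v + x * v" by (simp add: s_def algebra_simps)
  also have "\<dots> \<le> y * ((d + 2 * x) * (d + x + 1)) + x * ((y - d - 1) * (2 * y - d))"
    using assms by (intro add_mono mult_left_mono) auto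
  also have "\<dots> = y * a\<^sup>2 + x * b\<^sup>2 + x * y * s - s / 4"
    by (simp add: a_def b_def s_def field_simps power2_eq_square)
  also have "\<dots> \<le> max x y * (a\<^sup>2 + b\<^sup>2) + x * y * s"
  proof -
    have "y * a\<^sup>2 \<le> max x y * a\<^sup>2" "x * b\<^sup>2 \<le> max x y * b\<^sup>2" by (auto intro: mult_right_mono)
    thus ?thesis using s by (simp add: algebra_simps)
  qed
  also have "\<dots> \<le> max x y * s\<^sup>2 + x * y * s"
    using assms ab by (intro add_right_mono mult_left_mono) (auto simp: power2_sum)
  also have "\<dots> = s * (max x y * s + x * y)" by (simp add: power2_eq_square algebra_simps)
  also have "max x y * s + x * y \<le> s\<^sup>2"
  proof (cases "x \<le> y")
    case True
    have "s\<^sup>2 - (max x y * s + x * y) = x\<^sup>2"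
      using True by (simp add: s_def power2_eq_square algebra_simps max_def)
    thus ?thesis by (smt (verit) zero_le_power2)
  next
    case False
    have "s\<^sup>2 - (max x y * s + x * y) = y\<^sup>2"
      using False by (simp add: s_def power2_eq_square algebra_simps max_def)
    thus ?thesis by (smt (verit) zero_le_power2)
  qed
  finally have "s * v \<le> s * s\<^sup>2" using s by simp
  thus ?thesis using s by (simp add: s_def)
qed

context
  fixes v :: real
  assumes v_pos: "0 < v"
begin

lemma pois_pos: "0 < pois v k"
  using v_pos by simp

lemma pois_Suc: "real (Suc k) * pois v (Suc k) = v * pois v k"
proof -
  have "real (Suc k) * (v ^ Suc k / fact (Suc k)) = v * (v ^ k / fact k)"
    by (simp del: of_nat_Suc)
  hence "real (Suc k) * (v ^ Suc k / fact (Suc k)) * exp (- v) = v * (v ^ k / fact k) * exp (- v)"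
    by (rule arg_cong)
  thus ?thesis using v_pos by (simp only: pmf_poisson less_imp_le mult.assoc)
qed

lemma pois_log_concave: "pois v (Suc (Suc k)) * pois v k \<le> pois v (Suc k) * pois v (Suc k)"
proof -
  have "pois v (Suc (Suc k)) = v / real (Suc (Suc k)) * pois v (Suc k)"
    using pois_Suc[of "Suc k"] by (simp add: field_simps)
  moreover have "pois v k = real (Suc k) / v * pois v (Suc k)"
    using pois_Suc[of k] v_pos by (simp add: divide_simps mult.commute del: pmf_poisson)
  ultimately have "pois v (Suc (Suc k)) * pois v k
      = (real (Suc k) / real (Suc (Suc k))) * (pois v (Suc k) * pois v (Suc k))"
    using v_pos by (simp del: pmf_poisson of_nat_Suc)
  also have "\<dots> \<le> 1 * (pois v (Suc k) * pois v (Suc k))"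
    by (intro mult_right_mono) auto
  finally show ?thesis by simp
qed

lemma head_pos: "0 < head v k"
  by (induction k) (auto simp: head_0 head_Suc pois_pos intro: add_pos_pos)

lemma tail_pos: "0 < tail v k"
proof -
  have "0 \<le> tail v (Suc k)" by (simp add: tail_def)
  with tail_Suc[of v k] pois_pos[of "Suc k"] show ?thesis by linarith
qed

lemma pois_tendsto_0: "pois v \<longlonglongrightarrow> 0"
proof -
  have "(\<lambda>k. v ^ k / fact k * exp (- v)) \<longlonglongrightarrow> 0 * exp (- v)"
    using summable_LIMSEQ_zero[OF summable_exp[of v]] by (intro tendsto_intros) (simp add: field_simps)
  thus ?thesis using v_pos by simp
qed

lemma tail_tendsto_0: "tail v \<longlonglongrightarrow> 0"
proof -
  have "(\<lambda>k. tail v k) \<longlonglongrightarrow> pois_prob v (\<Inter>k. {k<..})"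
    unfolding tail_def
    by (rule measure_pmf.finite_Lim_measure_decseq) (auto simp: decseq_def)
  moreover have "(\<Inter>k::nat. {k<..}) = {}" by auto
  ultimately show ?thesis by simp
qed

text \<open>
  Log-concavity passes from point probabilities to tails: each increment of the shifted tail is at
  most the ratio at k times the corresponding increment of the tail.
\<close>

lemma tail_ratio_decreasing: "tail v (Suc k) * pois v k \<le> tail v k * pois v (Suc k)"
proof -
  let ?r = "pois v (Suc k) / pois v k"
  have "tail v (Suc k) \<le> ?r * tail v k"
  proof (rule le_of_tail_increments[where A = "\<lambda>i. tail v (Suc i)"])
    fix i assume "k \<le> i"
    have "pois v (Suc (Suc i)) = v / real (Suc (Suc i)) * pois v (Suc i)"
      using pois_Suc[of "Suc i"] by (simp add: field_simps)
    also have "\<dots> \<le> v / real (Suc k) * pois v (Suc i)"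
      using \<open>k \<le> i\<close> v_pos pois_pos[of "Suc i"]
      by (intro mult_right_mono divide_left_mono) (auto intro: less_imp_le)
    also have "v / real (Suc k) = ?r"
      using pois_Suc[of k] pois_pos[of k] by (simp add: field_simps)
    finally show "tail v (Suc i) - tail v (Suc (Suc i)) \<le> ?r * (tail v i - tail v (Suc i))"
      using tail_Suc[of v i] tail_Suc[of v "Suc i"] by simp
  qed (use tail_tendsto_0 in \<open>auto intro: LIMSEQ_Suc\<close>)
  thus ?thesis using pois_pos[of k] by (simp add: field_simps)
qed

lemma tail_over_pois_antimono:
  assumes "k \<le> n"
  shows "tail v n / pois v n \<le> tail v k / pois v k"
proof (rule lift_Suc_antimono_le[OF _ assms])
  fix k show "tail v (Suc k) / pois v (Suc k) \<le> tail v k / pois v k"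
    using tail_ratio_decreasing[of k] pois_pos[of k] pois_pos[of "Suc k"]
    by (simp add: divide_simps mult.commute del: pmf_poisson)
qed

lemma head_ratio_increasing: "head v k * pois v (Suc k) \<le> head v (Suc k) * pois v k"
proof (induction k)
  case 0
  thus ?case by (simp add: head_Suc head_0 distrib_right del: pmf_poisson)
next
  case (Suc k)
  have *: "pois v (Suc (Suc k)) / pois v (Suc k) \<le> pois v (Suc k) / pois v k"
    using pois_log_concave[of k] pois_pos[of k] pois_pos[of "Suc k"]
    by (simp add: divide_simps del: pmf_poisson)
  have "head v k * pois v (Suc (Suc k)) = head v k * pois v (Suc k) * (pois v (Suc (Suc k)) / pois v (Suc k))"
    using pois_pos[of "Suc k"] by simp
  also have "\<dots> \<le> head v (Suc k) * pois v k * (pois v (Suc k) / pois v k)"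
    using less_imp_le[OF head_pos] less_imp_le[OF pois_pos]
    by (intro mult_mono[OF Suc *] mult_nonneg_nonneg divide_nonneg_nonneg) auto
  also have "\<dots> = head v (Suc k) * pois v (Suc k)"
    using pois_pos[of k] by simp
  finally show ?case by (simp add: head_Suc distrib_right distrib_left del: pmf_poisson)
qed

lemma head_ratio_pois_Suc: "head v k * pois v (Suc (Suc k)) \<le> head v (Suc k) * pois v (Suc k)"
  using head_ratio_increasing[of "Suc k"] by (simp add: head_Suc distrib_right distrib_left del: pmf_poisson)

lemma head_over_pois_mono:
  assumes "k \<le> n"
  shows "head v k / pois v k \<le> head v n / pois v n"
proof (rule lift_Suc_mono_le[OF _ assms])
  fix k show "head v k / pois v k \<le> head v (Suc k) / pois v (Suc k)"
    using head_ratio_increasing[of k] pois_pos[of k] pois_pos[of "Suc k"]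
    by (simp add: divide_simps mult.commute del: pmf_poisson)
qed

text \<open>
  Let m be the mean of k - Y for Y \<sim> Po(v) conditioned on Y \<le> k; it equals (k - v) + x k because
  v - x k is the conditional mean of Y. Log-concavity makes k - Y at most as spread out as a
  geometric variable with mean m, in the form E[(k - Y) (k - Y - 1)] \<le> 2 m^2. The quadratic
  inequality is that moment bound written in terms of x.
\<close>

lemma head_quadratic:
  defines "x k \<equiv> v * pois v k / head v k"
  shows "0 \<le> (real k - v) + x k"
    and "v \<le> ((real k - v) + 2 * x k) * ((real k - v) + x k + 1)"
proof -
  note pos = pois_pos head_pos
  \<comment> \<open>H2 k is the sum of the heads below k, and H3 k the sum of H2 below k. Up to the factor
    head v k they are the mean of k - Y and half its second factorial moment. The closed forms come
    from v p(i) = (i + 1) p(i + 1).\<close>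
  define H2 where "H2 k = (real k - v) * head v k + v * pois v k" for k
  define H3 where "H3 k = (((real k - v)\<^sup>2 - real k + 2 * v) * head v k
    + (real k - 2 - v) * (v * pois v k)) / 2" for k
  have p: "v * pois v k = real (Suc k) * pois v (Suc k)" for k
    using pois_Suc[of k] by simp
  have H2_Suc: "H2 (Suc k) - H2 k = head v k" for k
    unfolding H2_def head_Suc p[of k] by (simp add: algebra_simps)
  have H3_Suc: "H3 (Suc k) - H3 k = H2 k" for k
    unfolding H3_def H2_def head_Suc p[of k] by (simp add: field_simps power2_eq_square)
  have H2_0: "H2 0 = 0" by (simp add: H2_def head_0)
  have H3_0: "H3 0 = 0" by (simp add: H3_def head_0 field_simps power2_eq_square)
  have H2_nonneg: "0 \<le> H2 k" for k
  proof (induction k)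
    case (Suc k)
    with H2_Suc[of k] pos(2)[of k] show ?case by linarith
  qed (simp add: H2_0)
  \<comment> \<open>Ratios of consecutive heads increase, hence so does H2 / head, and summing the latter
    once more bounds H3.\<close>
  have ratio: "head v i / head v (Suc i) \<le> head v k / head v (Suc k)" if "i \<le> k" for i k
  proof (rule lift_Suc_mono_le[OF _ that, where f = "\<lambda>i. head v i / head v (Suc i)"])
    fix i
    have "head v i * pois v (Suc (Suc i)) \<le> head v (Suc i) * pois v (Suc i)"
      using head_ratio_pois_Suc by simp
    hence "head v i * head v (Suc (Suc i)) \<le> head v (Suc i) * head v (Suc i)"
      by (simp add: head_Suc algebra_simps)
    thus "head v i / head v (Suc i) \<le> head v (Suc i) / head v (Suc (Suc i))"
      using pos(2) by (simp add: divide_simps)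
  qed
  have H2_ratio: "H2 k / head v k \<le> H2 (Suc k) / head v (Suc k)" for k
  proof -
    have "H2 k \<le> head v k / head v (Suc k) * H2 (Suc k)"
    proof (rule le_of_head_increments[where B = "\<lambda>i. H2 (Suc i)"])
      show "H2 0 \<le> head v k / head v (Suc k) * H2 (Suc 0)"
        using H2_nonneg[of "Suc 0"] less_imp_le[OF pos(2)] by (simp add: H2_0)
      fix i assume "i < k"
      hence "head v i / head v (Suc i) * head v (Suc i)
          \<le> head v k / head v (Suc k) * head v (Suc i)"
        using less_imp_le[OF pos(2)] by (intro mult_right_mono ratio) auto
      thus "H2 (Suc i) - H2 i \<le> head v k / head v (Suc k) * (H2 (Suc (Suc i)) - H2 (Suc i))"
        using pos(2)[of "Suc i"] by (simp add: H2_Suc)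
    qed
    thus ?thesis using pos(2)[of k] pos(2)[of "Suc k"] by (simp add: field_simps)
  qed
  have H3_le: "H3 k \<le> H2 k / head v k * H2 k"
  proof (rule le_of_head_increments)
    fix i assume "i < k"
    hence "H2 i / head v i * head v i \<le> H2 k / head v k * head v i"
      using lift_Suc_mono_le[of "\<lambda>i. H2 i / head v i", OF H2_ratio, of i k]
        less_imp_le[OF pos(2)[of i]] by (intro mult_right_mono) auto
    thus "H3 (Suc i) - H3 i \<le> H2 k / head v k * (H2 (Suc i) - H2 i)"
      using pos(2)[of i] by (simp add: H2_Suc H3_Suc)
  qed (simp add: H2_0 H3_0)
  define d where "d = real k - v"
  have x: "v * pois v k = x k * head v k"
    using pos(2)[of k] by (simp add: x_def)
  have H2_x: "H2 k = (d + x k) * head v k"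
    unfolding H2_def d_def x by (simp add: algebra_simps)
  show "0 \<le> (real k - v) + x k"
    using H2_nonneg[of k] pos(2)[of k] by (simp add: H2_x d_def zero_le_mult_iff)
  have H3_x: "H3 k = ((d\<^sup>2 - d + v) + (d - 2) * x k) / 2 * head v k"
    unfolding H3_def d_def x by (simp add: field_simps)
  have "((d\<^sup>2 - d + v) + (d - 2) * x k) / 2 * head v k \<le> (d + x k)\<^sup>2 * head v k"
    using H3_le pos(2)[of k] by (simp add: H3_x H2_x power2_eq_square)
  hence "((d\<^sup>2 - d + v) + (d - 2) * x k) / 2 \<le> (d + x k)\<^sup>2"
    using pos(2)[of k] by simp
  thus "v \<le> ((real k - v) + 2 * x k) * ((real k - v) + x k + 1)"
    by (simp add: d_def[symmetric] power2_eq_square algebra_simps)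
qed

lemma tail_ratio_pois_Suc: "tail v (Suc k) * pois v (Suc k) \<le> tail v k * pois v (Suc (Suc k))"
  using tail_ratio_decreasing[of k] tail_ratio_decreasing[of "Suc k"]
  by (subst tail_Suc[of v k], subst tail_Suc[of v "Suc k"]) (simp add: algebra_simps)

lemma power_pois_tendsto_0:
  "(\<lambda>k. real k * pois v k) \<longlonglongrightarrow> 0" "(\<lambda>k. (real k)\<^sup>2 * pois v k) \<longlonglongrightarrow> 0"
proof -
  note p0 = pois_tendsto_0
  have "(\<lambda>k. real (Suc k) * pois v (Suc k)) \<longlonglongrightarrow> v * 0"
    unfolding pois_Suc by (intro tendsto_intros p0)
  thus p1: "(\<lambda>k. real k * pois v k) \<longlonglongrightarrow> 0"
    by (subst (asm) filterlim_sequentially_Suc) simp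
  have "(\<lambda>k. v * (real k * pois v k + pois v k)) \<longlonglongrightarrow> v * (0 + 0)"
    by (intro tendsto_intros p0 p1)
  moreover have "v * (real k * pois v k + pois v k) = (real (Suc k))\<^sup>2 * pois v (Suc k)" for k
  proof -
    have "v * (real k * pois v k + pois v k) = real (Suc k) * (v * pois v k)"
      by (simp add: algebra_simps)
    thus ?thesis
      unfolding pois_Suc[of k, symmetric] power2_eq_square mult.assoc .
  qed
  ultimately have "(\<lambda>k. (real (Suc k))\<^sup>2 * pois v (Suc k)) \<longlonglongrightarrow> v * (0 + 0)" by simp
  thus "(\<lambda>k. (real k)\<^sup>2 * pois v k) \<longlonglongrightarrow> 0"
    by (subst (asm) filterlim_sequentially_Suc) simp
qed

lemma power_tail_tendsto_0:
  "(\<lambda>k. real k * tail v k) \<longlonglongrightarrow> 0" "(\<lambda>k. (real k)\<^sup>2 * tail v k) \<longlonglongrightarrow> 0"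
proof -
  have "tail v k \<le> tail v 0 / pois v 0 * pois v k" for k
    using tail_over_pois_antimono[of 0 k] pois_pos[of k]
    by (simp add: pos_divide_le_eq del: pmf_poisson)
  hence *: "(\<lambda>k. c k * tail v k) \<longlonglongrightarrow> 0" if "(\<lambda>k. c k * pois v k) \<longlonglongrightarrow> 0" "\<And>k. 0 \<le> c k" for c
  proof (intro tendsto_sandwich[OF _ _ tendsto_const tendsto_mult_right_zero[OF that(1)]])
    show "\<forall>\<^sub>F k in sequentially. 0 \<le> c k * tail v k"
      using that(2) less_imp_le[OF tail_pos] by auto
    show "\<forall>\<^sub>F k in sequentially. c k * tail v k \<le> tail v 0 / pois v 0 * (c k * pois v k)"
      using mult_left_mono[OF \<open>\<And>k. tail v k \<le> _\<close> that(2)] by (simp add: mult.left_commute)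
  qed
  show "(\<lambda>k. real k * tail v k) \<longlonglongrightarrow> 0" "(\<lambda>k. (real k)\<^sup>2 * tail v k) \<longlonglongrightarrow> 0"
    using power_pois_tendsto_0 by (auto intro!: *)
qed

text \<open>
  The mirror image of \<open>head_quadratic\<close> for Y - k - 1 conditioned on Y > k, whose mean is
  y k - (k - v) - 1, since v + y k is the conditional mean of Y.
\<close>

lemma tail_quadratic:
  defines "y k \<equiv> v * pois v k / tail v k"
  shows "0 \<le> y k - (real k - v) - 1"
    and "v \<le> (y k - (real k - v) - 1) * (2 * y k - (real k - v))"
proof -
  note pos = pois_pos tail_pos
  \<comment> \<open>T2 k is the sum of the tails beyond k, and T3 k the sum of T2 beyond k.\<close>
  define T2 where "T2 k = v * pois v k - (real k + 1 - v) * tail v k" for k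
  define T3 where "T3 k = (((real k + 1 - v)\<^sup>2 + real k + 1) * tail v k
    - (real k + 2 - v) * (v * pois v k)) / 2" for k
  have p: "v * pois v k = real (Suc k) * pois v (Suc k)" for k
    using pois_Suc[of k] by simp
  have T2_Suc: "T2 k - T2 (Suc k) = tail v (Suc k)" for k
    unfolding T2_def tail_Suc[of v k] p[of k] by (simp add: algebra_simps)
  have T3_Suc: "T3 k - T3 (Suc k) = T2 (Suc k)" for k
    unfolding T3_def T2_def tail_Suc[of v k] p[of k] by (simp add: field_simps power2_eq_square)
  have T2_lim: "T2 \<longlonglongrightarrow> 0"
  proof -
    have "(\<lambda>k. v * pois v k - (real k * tail v k + (1 - v) * tail v k))
        \<longlonglongrightarrow> v * 0 - (0 + (1 - v) * 0)"
      by (intro tendsto_intros power_tail_tendsto_0 pois_tendsto_0 tail_tendsto_0 v_pos)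
    thus ?thesis by (simp add: T2_def[abs_def] algebra_simps)
  qed
  have T3_lim: "T3 \<longlonglongrightarrow> 0"
  proof -
    have "(\<lambda>k. ((real k)\<^sup>2 * tail v k + (3 - 2 * v) * (real k * tail v k) + ((1 - v)\<^sup>2 + 1) * tail v k
          - v * (real k * pois v k) - (2 - v) * v * pois v k) / 2)
        \<longlonglongrightarrow> (0 + (3 - 2 * v) * 0 + ((1 - v)\<^sup>2 + 1) * 0 - v * 0 - (2 - v) * v * 0) / 2"
      by (intro tendsto_intros power_tail_tendsto_0 power_pois_tendsto_0
          pois_tendsto_0 tail_tendsto_0 v_pos) auto
    moreover have "T3 = (\<lambda>k. ((real k)\<^sup>2 * tail v k + (3 - 2 * v) * (real k * tail v k)
        + ((1 - v)\<^sup>2 + 1) * tail v k - v * (real k * pois v k) - (2 - v) * v * pois v k) / 2)"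
      unfolding T3_def by (rule ext) (simp add: algebra_simps power2_eq_square)
    ultimately show ?thesis by simp
  qed
  have T2_nonneg: "0 \<le> T2 k" for k
    using le_of_tail_increments[of "\<lambda>_. 0" T2 k 1] T2_lim less_imp_le[OF pos(2)]
    by (simp add: T2_Suc)
  have ratio: "tail v (Suc i) / tail v i \<le> tail v (Suc k) / tail v k" if "k \<le> i" for i k
  proof (rule lift_Suc_antimono_le[OF _ that, where f = "\<lambda>i. tail v (Suc i) / tail v i"])
    fix i
    have "tail v (Suc (Suc i)) * tail v i \<le> tail v (Suc i) * tail v (Suc i)"
      using tail_ratio_pois_Suc[of i] tail_Suc[of v i] tail_Suc[of v "Suc i"]
      by (simp add: algebra_simps)
    thus "tail v (Suc (Suc i)) / tail v (Suc i) \<le> tail v (Suc i) / tail v i"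
      using pos(2) by (simp add: divide_simps)
  qed
  have T2_ratio: "T2 (Suc k) / tail v (Suc k) \<le> T2 k / tail v k" for k
  proof -
    have "T2 (Suc k) \<le> tail v (Suc k) / tail v k * T2 k"
    proof (rule le_of_tail_increments[where A = "\<lambda>i. T2 (Suc i)"])
      fix i assume "k \<le> i"
      hence "tail v (Suc (Suc i)) / tail v (Suc i) * tail v (Suc i)
          \<le> tail v (Suc k) / tail v k * tail v (Suc i)"
        using less_imp_le[OF pos(2)] by (intro mult_right_mono ratio) auto
      thus "T2 (Suc i) - T2 (Suc (Suc i)) \<le> tail v (Suc k) / tail v k * (T2 i - T2 (Suc i))"
        using pos(2)[of "Suc i"] by (simp add: T2_Suc)
    qed (use T2_lim LIMSEQ_Suc in auto)
    thus ?thesis using pos(2)[of k] pos(2)[of "Suc k"] by (simp add: field_simps)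
  qed
  have T3_le: "T3 k \<le> T2 k / tail v k * T2 k"
  proof (rule le_of_tail_increments[OF T3_lim T2_lim])
    fix i assume "k \<le> i"
    hence "T2 (Suc i) / tail v (Suc i) * tail v (Suc i) \<le> T2 k / tail v k * tail v (Suc i)"
      using lift_Suc_antimono_le[of "\<lambda>i. T2 i / tail v i", OF T2_ratio, of k "Suc i"]
        less_imp_le[OF pos(2)[of "Suc i"]] by (intro mult_right_mono) auto
    thus "T3 i - T3 (Suc i) \<le> T2 k / tail v k * (T2 i - T2 (Suc i))"
      using pos(2)[of "Suc i"] by (simp add: T2_Suc T3_Suc)
  qed
  define d where "d = real k - v"
  have k: "real k = d + v" by (simp add: d_def)
  have y: "v * pois v k = y k * tail v k"
    using pos(2)[of k] by (simp add: y_def)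
  have T2_y: "T2 k = (y k - d - 1) * tail v k"
    unfolding T2_def k y by (simp add: algebra_simps)
  show "0 \<le> y k - (real k - v) - 1"
    using T2_nonneg[of k] pos(2)[of k] by (simp add: T2_y d_def zero_le_mult_iff)
  have T3_y: "T3 k = (((d + 1)\<^sup>2 + d + v + 1) - (d + 2) * y k) / 2 * tail v k"
    unfolding T3_def k y by (simp add: field_simps)
  have "(((d + 1)\<^sup>2 + d + v + 1) - (d + 2) * y k) / 2 * tail v k \<le> (y k - d - 1)\<^sup>2 * tail v k"
    using T3_le pos(2)[of k] by (simp add: T3_y T2_y power2_eq_square)
  hence "(((d + 1)\<^sup>2 + d + v + 1) - (d + 2) * y k) / 2 \<le> (y k - d - 1)\<^sup>2"
    using pos(2)[of k] by simp
  thus "v \<le> (y k - (real k - v) - 1) * (2 * y k - (real k - v))"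
    by (simp add: d_def[symmetric] power2_eq_square field_simps)
qed

text \<open>
  With x and y as in the two quadratic bounds, x + y = v p / (F T) because F + T = 1 for the head F
  and the tail T, while the conditional means are x + y \<ge> sqrt v apart.
\<close>

lemma head_mult_tail_le: "head v k * tail v k \<le> sqrt v * pois v k"
proof -
  note pos = pois_pos[of k] head_pos[of k] tail_pos[of k]
  let ?x = "v * pois v k / head v k" and ?y = "v * pois v k / tail v k"
  have "v \<le> (?x + ?y)\<^sup>2"
    using pos v_pos head_quadratic[of k] tail_quadratic[of k]
    by (intro square_le_of_two_quadratics[where d = "real k - v"]) auto
  hence "sqrt v \<le> ?x + ?y"
    using pos v_pos by (intro real_le_lsqrt) (auto intro!: add_nonneg_nonneg simp del: pmf_poisson)
  also have "\<dots> = v * pois v k * (head v k + tail v k) / (head v k * tail v k)"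
    using pos by (simp add: field_simps)
  finally have "sqrt v * (head v k * tail v k) \<le> v * pois v k"
    using pos by (simp add: head_add_tail field_simps)
  also have "\<dots> = sqrt v * (sqrt v * pois v k)"
    using v_pos by (simp flip: mult.assoc)
  finally show ?thesis using v_pos by (simp del: pmf_poisson)
qed

end

section \<open>The Poisson Stein equation\<close>

text \<open>
  The solution of v g(k + 1) - k g(k) = 1_B(k) - Po(v)(B). The equation says nothing about g(0), since
  k = 0 cancels it; with the value 0 the solution continues as the constant 0 to the negative
  integers, and the bounds on its differences hold at the origin too.
\<close>

definition stein_solution :: "real \<Rightarrow> nat set \<Rightarrow> nat \<Rightarrow> real" where
  "stein_solution v B n = (case n of 0 \<Rightarrow> 0 | Suc k \<Rightarrow>
     (pois_prob v (B \<inter> {..k})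
       - pois_prob v B * head v k) / (v * pois v k))"

lemma stein_solution_0 [simp]: "stein_solution v B 0 = 0"
  by (simp add: stein_solution_def)

context
  fixes v :: real
  assumes v_pos: "0 < v"
begin

lemma prob_Int_atMost_0: "pois_prob v (B \<inter> {0}) = indicator B 0 * pois v 0"
  by (cases "0 \<in> B") (auto simp: measure_pmf_single)

lemma prob_Int_atMost_Suc:
  "pois_prob v (B \<inter> {..Suc k}) = pois_prob v (B \<inter> {..k}) + indicator B (Suc k) * pois v (Suc k)"
proof (cases "Suc k \<in> B")
  case True
  hence "B \<inter> {..Suc k} = insert (Suc k) (B \<inter> {..k})" by auto
  thus ?thesis using True by (simp add: measure_measure_pmf_finite)
next
  case False
  hence "B \<inter> {..Suc k} = B \<inter> {..k}" by (auto simp: le_Suc_eq)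
  thus ?thesis using False by simp
qed

lemma prob_split: "pois_prob v B = pois_prob v (B \<inter> {..k}) + pois_prob v (B \<inter> {k<..})"
proof -
  have "pois_prob v ((B \<inter> {..k}) \<union> (B \<inter> {k<..})) = pois_prob v (B \<inter> {..k}) + pois_prob v (B \<inter> {k<..})"
    by (rule measure_pmf.finite_measure_Union) auto
  moreover have "(B \<inter> {..k}) \<union> (B \<inter> {k<..}) = B" by auto
  ultimately show ?thesis by simp
qed

lemma stein_solution_Suc:
  "stein_solution v B (Suc k) = (pois_prob v (B \<inter> {..k}) * tail v k - pois_prob v (B \<inter> {k<..}) * head v k) / (v * pois v k)"
proof -
  have "pois_prob v (B \<inter> {..k}) - pois_prob v B * head v k
      = pois_prob v (B \<inter> {..k}) * (head v k + tail v k) - pois_prob v B * head v k"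
    by (simp add: head_add_tail)
  also have "\<dots> = pois_prob v (B \<inter> {..k}) * tail v k - pois_prob v (B \<inter> {k<..}) * head v k"
    by (simp add: prob_split[of B k] algebra_simps)
  finally show ?thesis by (simp add: stein_solution_def)
qed

lemma stein_equation:
  "v * stein_solution v B (Suc k) - real k * stein_solution v B k = indicator B k - pois_prob v B"
proof (cases k)
  case 0
  have "v * stein_solution v B (Suc 0) = (indicator B 0 * pois v 0 - pois_prob v B * pois v 0) / pois v 0"
    using v_pos by (simp add: stein_solution_def prob_Int_atMost_0 head_0 del: pmf_poisson)
  also have "\<dots> = indicator B 0 - pois_prob v B"
    using pois_pos[OF v_pos, of 0] by (simp add: diff_divide_distrib del: pmf_poisson)
  finally show ?thesis using 0 by simp
next
  case (Suc j)
  note pos = pois_pos[OF v_pos, of j] pois_pos[OF v_pos, of "Suc j"]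
  have "v * stein_solution v B (Suc k) - real k * stein_solution v B k
     = (pois_prob v (B \<inter> {..Suc j}) - pois_prob v B * head v (Suc j)) / pois v (Suc j)
       - real (Suc j) * ((pois_prob v (B \<inter> {..j}) - pois_prob v B * head v j) / (v * pois v j))"
    using v_pos by (simp add: stein_solution_def Suc del: pmf_poisson)
  also have "\<dots> = (pois_prob v (B \<inter> {..Suc j}) - pois_prob v B * head v (Suc j)) / pois v (Suc j)
       - (pois_prob v (B \<inter> {..j}) - pois_prob v B * head v j) / pois v (Suc j)"
    using pos unfolding pois_Suc[OF v_pos, symmetric] by (simp del: pmf_poisson of_nat_Suc)
  also have "\<dots> = indicator B (Suc j) - pois_prob v B"
    using pos by (simp add: prob_Int_atMost_Suc head_Suc field_simps)
  finally show ?thesis by (simp add: Suc)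
qed

text \<open>
  Among all B, the numerator in \<open>stein_solution_Suc\<close> is extremal for B = {..k} and
  B = {k<..}, where it is \<plusminus> head v k * tail v k.
\<close>

lemma abs_stein_le: "\<bar>stein_solution v B n\<bar> \<le> 1 / sqrt v"
proof (cases n)
  case (Suc k)
  let ?a = "pois_prob v (B \<inter> {..k})" and ?c = "pois_prob v (B \<inter> {k<..})"
  note pos = pois_pos[OF v_pos, of k] head_pos[OF v_pos, of k] tail_pos[OF v_pos, of k]
  have "?a \<le> head v k" "?c \<le> tail v k"
    unfolding head_def tail_def by (auto intro!: measure_pmf.finite_measure_mono)
  hence "?a * tail v k \<le> head v k * tail v k" "?c * head v k \<le> head v k * tail v k"
    using pos by (auto simp: mult.commute)
  moreover have "0 \<le> ?a * tail v k" "0 \<le> ?c * head v k"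
    using pos by auto
  ultimately have "\<bar>?a * tail v k - ?c * head v k\<bar> \<le> sqrt v * pois v k"
    using head_mult_tail_le[OF v_pos, of k] by linarith
  hence "\<bar>stein_solution v B n\<bar> \<le> sqrt v * pois v k / (v * pois v k)"
    using pos v_pos unfolding Suc stein_solution_Suc abs_divide by (intro frac_le) auto
  also have "\<dots> = 1 / sqrt v"
    using pos v_pos by (simp add: field_simps del: pmf_poisson)
  finally show ?thesis .
qed (use v_pos in simp)

text \<open>
  Write B as the union of its parts below, at and above k. Since tail/pois decreases and head/pois
  increases, only the part at k contributes positively to the difference at k, and by at most 1/v. The
  contributions of all points add up to 0 (for B = UNIV the solution vanishes), so the negative ones
  are bounded as well.
\<close>

lemma abs_stein_diff_le: "\<bar>stein_solution v B (Suc k) - stein_solution v B k\<bar> \<le> 1 / v"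
proof (cases k)
  case 0
  have "pois_prob v (B \<inter> {0<..}) \<le> tail v 0"
    unfolding tail_def by (auto intro!: measure_pmf.finite_measure_mono)
  hence *: "pois_prob v (B \<inter> {0<..}) \<le> 1" "tail v 0 \<le> 1" "0 \<le> pois_prob v (B \<inter> {0<..})" "0 \<le> tail v 0"
    by (auto simp: tail_def)
  have "v * stein_solution v B (Suc 0) = indicator B 0 * tail v 0 - pois_prob v (B \<inter> {0<..})"
    using v_pos pois_pos[OF v_pos, of 0]
    by (simp add: stein_solution_Suc prob_Int_atMost_0 head_0 field_simps)
  moreover have "indicator B 0 * tail v 0 \<le> 1" "0 \<le> indicator B 0 * tail v 0"
    using * by (auto simp: indicator_def)
  ultimately have "\<bar>v * stein_solution v B (Suc 0)\<bar> \<le> 1"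
    using * by linarith
  thus ?thesis using 0 v_pos by (simp add: abs_mult field_simps)
next
  case (Suc j)
  let ?F = "head v j" and ?F' = "head v (Suc j)" and ?T = "tail v j" and ?T' = "tail v (Suc j)"
    and ?p = "pois v j" and ?p' = "pois v (Suc j)"
    and ?i = "indicator B (Suc j) :: real"
    and ?a = "pois_prob v (B \<inter> {..j})" and ?c = "pois_prob v (B \<inter> {Suc j<..})"
  note pos = pois_pos[OF v_pos, of j] pois_pos[OF v_pos, of "Suc j"]
  have c: "pois_prob v (B \<inter> {j<..}) = ?c + ?i * ?p'"
    using prob_split[of B j] prob_split[of B "Suc j"] prob_Int_atMost_Suc[of B j] by linarith
  have "v * stein_solution v B (Suc k) = ((?a + ?i * ?p') * ?T' - ?c * ?F') / ?p'"
    using v_pos by (simp add: Suc stein_solution_Suc prob_Int_atMost_Suc del: pmf_poisson)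
  moreover have "v * stein_solution v B k = (?a * ?T - (?c + ?i * ?p') * ?F) / ?p"
    using v_pos by (simp add: Suc stein_solution_Suc c del: pmf_poisson)
  ultimately have "v * (stein_solution v B (Suc k) - stein_solution v B k)
      = ((?a + ?i * ?p') * ?T' - ?c * ?F') / ?p' - (?a * ?T - (?c + ?i * ?p') * ?F) / ?p"
    by (simp only: right_diff_distrib)
  also have "\<dots> = ?a * (?T' / ?p' - ?T / ?p) + ?i * (?T' + ?p' * ?F / ?p) - ?c * (?F' / ?p' - ?F / ?p)"
    using pos by (simp add: field_simps)
  finally have eq: "v * (stein_solution v B (Suc k) - stein_solution v B k) = \<dots>" .
  have jump: "0 \<le> ?T' + ?p' * ?F / ?p" "?T' + ?p' * ?F / ?p \<le> 1"
  proof -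
    have "?p' * ?F / ?p \<le> ?F'"
      using head_ratio_increasing[OF v_pos, of j] pos
      by (simp add: pos_divide_le_eq mult.commute del: pmf_poisson)
    thus "?T' + ?p' * ?F / ?p \<le> 1" using head_add_tail[of v "Suc j"] by linarith
    show "0 \<le> ?T' + ?p' * ?F / ?p"
      using pos by (simp add: head_def tail_def del: pmf_poisson)
  qed
  have neg: "?T' / ?p' - ?T / ?p \<le> 0" "0 \<le> ?F' / ?p' - ?F / ?p"
    using tail_over_pois_antimono[OF v_pos, of j "Suc j"] head_over_pois_mono[OF v_pos, of j "Suc j"]
    by auto
  have ac: "0 \<le> ?a" "?a \<le> ?F" "0 \<le> ?c" "?c \<le> ?T'"
    unfolding head_def tail_def by (auto intro!: measure_pmf.finite_measure_mono)
  have "?a * (?T' / ?p' - ?T / ?p) \<le> 0" "0 \<le> ?c * (?F' / ?p' - ?F / ?p)"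
    using ac neg by (auto intro: mult_nonneg_nonpos)
  moreover have "?i * (?T' + ?p' * ?F / ?p) \<le> 1" "0 \<le> ?i * (?T' + ?p' * ?F / ?p)"
    using jump by (auto simp: indicator_def)
  moreover have "?F * (?T' / ?p' - ?T / ?p) \<le> ?a * (?T' / ?p' - ?T / ?p)"
    using ac neg by (intro mult_right_mono_neg) auto
  moreover have "?c * (?F' / ?p' - ?F / ?p) \<le> ?T' * (?F' / ?p' - ?F / ?p)"
    using ac neg by (intro mult_right_mono) auto
  \<comment> \<open>the case B = UNIV, which balances the negative contributions against the jump\<close>
  moreover have "?F * (?T' / ?p' - ?T / ?p) - ?T' * (?F' / ?p' - ?F / ?p) = - (?T' + ?p' * ?F / ?p)"
  proof -
    have "?T = ?T' + ?p'" "?F' = ?F + ?p'" by (rule tail_Suc, rule head_Suc)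
    thus ?thesis using pos by (simp add: field_simps)
  qed
  ultimately have "\<bar>v * (stein_solution v B (Suc k) - stein_solution v B k)\<bar> \<le> 1"
    unfolding eq using jump by linarith
  thus ?thesis using v_pos by (simp add: abs_mult pos_le_divide_eq mult.commute)
qed

lemma stein_singleton:
  "k < j \<Longrightarrow> stein_solution v {j} (Suc k) = - (pois v j / v) * (head v k / pois v k)"
  "j \<le> k \<Longrightarrow> stein_solution v {j} (Suc k) = pois v j / v * (tail v k / pois v k)"
  by (simp_all add: stein_solution_Suc measure_pmf_single del: pmf_poisson)

text \<open>
  The shape of the solution for a single point j: it falls from 0 until j, jumps up to a positive
  value at j + 1, and falls again. Hence its variation is controlled by the jump alone.
\<close>

lemma stein_singleton_monotone:
  "k < j \<Longrightarrow> stein_solution v {j} (Suc k) \<le> stein_solution v {j} k"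
  "j < k \<Longrightarrow> stein_solution v {j} (Suc k) \<le> stein_solution v {j} k"
  "k \<le> j \<Longrightarrow> stein_solution v {j} k \<le> 0"
  "j \<le> k \<Longrightarrow> 0 \<le> stein_solution v {j} (Suc k)"
proof -
  have c: "0 \<le> pois v j / v" using v_pos by simp
  have nn: "0 \<le> head v k / pois v k" "0 \<le> tail v k / pois v k" for k
    using v_pos by (auto simp: head_def tail_def)
  show le: "k \<le> j \<Longrightarrow> stein_solution v {j} k \<le> 0" for k
    using mult_nonneg_nonneg[OF c nn(1)]
    by (cases k) (auto simp: stein_singleton simp del: pmf_poisson)
  show "j \<le> k \<Longrightarrow> 0 \<le> stein_solution v {j} (Suc k)"
    using mult_nonneg_nonneg[OF c nn(2)] by (auto simp: stein_singleton simp del: pmf_poisson)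
  show "stein_solution v {j} (Suc k) \<le> stein_solution v {j} k" if "k < j"
  proof (cases k)
    case 0
    thus ?thesis using le[of "Suc 0"] that by simp
  next
    case (Suc l)
    have "pois v j / v * (head v l / pois v l) \<le> pois v j / v * (head v k / pois v k)"
      by (intro mult_left_mono head_over_pois_mono[OF v_pos] c) (simp add: Suc)
    thus ?thesis using that Suc by (simp add: stein_singleton del: pmf_poisson)
  qed
  show "stein_solution v {j} (Suc k) \<le> stein_solution v {j} k" if "j < k"
  proof -
    obtain l where Suc: "k = Suc l" using \<open>j < k\<close> by (cases k) auto
    have "pois v j / v * (tail v k / pois v k) \<le> pois v j / v * (tail v l / pois v l)"
      by (intro mult_left_mono tail_over_pois_antimono[OF v_pos] c) (simp add: Suc)
    thus ?thesis using that Suc by (simp add: stein_singleton del: pmf_poisson)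
  qed
qed

lemma sum_abs_stein_singleton_diff:
  "(\<Sum>k<n. \<bar>stein_solution v {j} (Suc k) - stein_solution v {j} k\<bar>)
     = (if n \<le> j then - stein_solution v {j} n else 2 * (stein_solution v {j} (Suc j) - stein_solution v {j} j) - stein_solution v {j} n)"
proof (induction n)
  case (Suc n)
  note mono = stein_singleton_monotone[where k = n and j = j]
  consider "n < j" | "n = j" | "j < n" by linarith
  thus ?case
  proof cases
    case 1
    thus ?thesis using Suc mono(1) by simp
  next
    case 2
    thus ?thesis using Suc mono(3,4) by simp
  next
    case 3
    thus ?thesis using Suc mono(2)[OF 3] by simp
  qed
qed simp

lemma sum_abs_stein_singleton_diff_le:
  "(\<Sum>k<n. \<bar>stein_solution v {j} (Suc k) - stein_solution v {j} k\<bar>) \<le> 2 / v"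
proof -
  let ?V = "\<lambda>n. \<Sum>k<n. \<bar>stein_solution v {j} (Suc k) - stein_solution v {j} k\<bar>"
  have "?V n \<le> ?V (max n (Suc j))"
    by (rule sum_mono2) auto
  also have "\<dots> \<le> 2 * (stein_solution v {j} (Suc j) - stein_solution v {j} j)"
    unfolding sum_abs_stein_singleton_diff
    using stein_singleton_monotone(4)[of j "max n (Suc j) - 1"] by (auto simp: max_def split: if_splits)
  also have "\<dots> \<le> 2 * (1 / v)"
    by (intro mult_left_mono abs_le_D1[OF abs_stein_diff_le]) simp
  finally show ?thesis by simp
qed

lemma abs_stein_singleton_le: "\<bar>stein_solution v {j} n\<bar> \<le> 1 / v"
proof -
  let ?g = "stein_solution v {j}"
  have jump: "?g (Suc j) - ?g j \<le> 1 / v" using abs_stein_diff_le[of "{j}" j] by linarith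
  note signs = stein_singleton_monotone(3)[of j j] stein_singleton_monotone(4)[of j j]
  show ?thesis
  proof (cases "n \<le> j")
    case True
    have "?g j \<le> ?g n"
      using True
    proof (induction rule: inc_induct)
      case (step m)
      thus ?case using stein_singleton_monotone(1)[of m j] by linarith
    qed simp
    thus ?thesis using stein_singleton_monotone(3)[of n j] True jump signs by linarith
  next
    case False
    hence "Suc j \<le> n" by simp
    hence "?g n \<le> ?g (Suc j)"
    proof (induction rule: dec_induct)
      case (step m)
      thus ?case using stein_singleton_monotone(2)[of j m] by linarith
    qed simp
    thus ?thesis using stein_singleton_monotone(4)[of j "n - 1"] False jump signs by auto
  qed
qed

end

section \<open>Exchangeable pairs with unit steps\<close>

lemma Cauchy_Schwarz_integral:
  fixes X Y :: "'a \<Rightarrow> real"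
  assumes [measurable]: "X \<in> borel_measurable M" "Y \<in> borel_measurable M"
    and X2: "integrable M (\<lambda>x. (X x)\<^sup>2)" and Y2: "integrable M (\<lambda>x. (Y x)\<^sup>2)"
  shows "integrable M (\<lambda>x. X x * Y x)"
    and "\<bar>\<integral>x. X x * Y x \<partial>M\<bar> \<le> sqrt (\<integral>x. (X x)\<^sup>2 \<partial>M) * sqrt (\<integral>x. (Y x)\<^sup>2 \<partial>M)"
proof -
  show XY: "integrable M (\<lambda>x. X x * Y x)"
  proof (rule Bochner_Integration.integrable_bound[OF Bochner_Integration.integrable_add[OF X2 Y2]])
    have "\<bar>X x * Y x\<bar> \<le> (X x)\<^sup>2 + (Y x)\<^sup>2" for x
      using sum_squares_bound[of "\<bar>X x\<bar>" "\<bar>Y x\<bar>"] mult_nonneg_nonneg[OF abs_ge_zero abs_ge_zero, of "X x" "Y x"]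
      by (simp add: abs_mult mult.assoc del: mult_nonneg_nonneg)
    thus "AE x in M. norm (X x * Y x) \<le> norm ((X x)\<^sup>2 + (Y x)\<^sup>2)" by simp
  qed simp
  define A B I where "A = (\<integral>x. (X x)\<^sup>2 \<partial>M)" and "B = (\<integral>x. (Y x)\<^sup>2 \<partial>M)" and "I = (\<integral>x. X x * Y x \<partial>M)"
  have AB: "0 \<le> A" "0 \<le> B" by (simp_all add: A_def B_def)
  have quad: "0 \<le> t\<^sup>2 * A - 2 * t * I + B" for t
  proof -
    have "0 \<le> (\<integral>x. (t * X x - Y x)\<^sup>2 \<partial>M)" by simp
    also have "(\<integral>x. (t * X x - Y x)\<^sup>2 \<partial>M) = (\<integral>x. t\<^sup>2 * (X x)\<^sup>2 - 2 * t * (X x * Y x) + (Y x)\<^sup>2 \<partial>M)"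
      by (simp add: power2_diff power_mult_distrib algebra_simps)
    also have "\<dots> = t\<^sup>2 * A - 2 * t * I + B"
      using X2 Y2 XY by (simp add: A_def B_def I_def)
    finally show ?thesis .
  qed
  have "I\<^sup>2 \<le> A * B"
  proof (cases "A = 0")
    case True
    \<comment> \<open>otherwise the quadratic degenerates to a nonconstant linear function of t\<close>
    have "I = 0"
    proof (rule ccontr)
      assume "I \<noteq> 0"
      with quad[of "(B + 1) / (2 * I)"] True show False by simp
    qed
    thus ?thesis using True by simp
  next
    case False
    thus ?thesis using quad[of "I / A"] AB by (simp add: field_simps power2_eq_square)
  qed
  hence "sqrt (I\<^sup>2) \<le> sqrt (A * B)" by (rule real_sqrt_le_mono)
  thus "\<bar>\<integral>x. X x * Y x \<partial>M\<bar> \<le> sqrt (\<integral>x. (X x)\<^sup>2 \<partial>M) * sqrt (\<integral>x. (Y x)\<^sup>2 \<partial>M)"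
    by (simp add: A_def B_def I_def real_sqrt_mult)
qed

locale exchangeable_regression = prob_space M for M :: "'a measure" +
  fixes W W' :: "'a \<Rightarrow> int" and R :: "'a \<Rightarrow> real" and \<mu> \<sigma> lam :: real
  assumes W_meas [measurable]: "W \<in> measurable M (count_space UNIV)"
    and W'_meas [measurable]: "W' \<in> measurable M (count_space UNIV)"
    and R_meas [measurable]: "R \<in> borel_measurable M"
    and exch: "exchangeable M W W'"
    and mean_W: "expectation (\<lambda>\<omega>. real_of_int (W \<omega>)) = \<mu>"
    and square_integrable_W: "integrable M (\<lambda>\<omega>. (real_of_int (W \<omega>))\<^sup>2)"
    and variance_W: "variance (\<lambda>\<omega>. real_of_int (W \<omega>)) = \<sigma>\<^sup>2"
    and sigma_pos: "0 < \<sigma>" and lam_pos: "0 < lam"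
    and regression: "AE \<omega> in M. cond_exp_given M W (\<lambda>\<omega>. real_of_int (W' \<omega>) - \<mu>) \<omega>
                     = (1 - lam) * (real_of_int (W \<omega>) - \<mu>) + R \<omega>"
    and step: "AE \<omega> in M. W' \<omega> - W \<omega> \<in> {-1, 0, 1}"
begin

abbreviation "F \<equiv> vimage_algebra (space M) W (count_space UNIV)"
abbreviation "S \<equiv> cond_prob_given M W (\<lambda>\<omega>. W' \<omega> = W \<omega> + 1)"
abbreviation "up \<equiv> (indicator {\<omega> \<in> space M. W' \<omega> = W \<omega> + 1} :: 'a \<Rightarrow> real)"

lemma measurable_of_W: "(\<lambda>\<omega>. h (W \<omega>)) \<in> borel_measurable M"
  by (rule measurable_compose[OF W_meas]) simp

lemma measurable_of_W_F: "(\<lambda>\<omega>. h (W \<omega>)) \<in> borel_measurable F"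
  by (rule measurable_compose[OF measurable_vimage_algebra1]) auto

sublocale cond: finite_measure_subalgebra M F
proof
  show "subalgebra M F"
    unfolding subalgebra_def using W_meas by (auto simp: sets_vimage_algebra2 dest: measurable_sets)
qed

lemma measurable_of_pair:
  fixes \<phi> :: "int \<Rightarrow> int \<Rightarrow> real"
  assumes "X \<in> measurable M (count_space UNIV)" "Y \<in> measurable M (count_space UNIV)"
  shows "(\<lambda>\<omega>. \<phi> (X \<omega>) (Y \<omega>)) \<in> borel_measurable M"
proof -
  have "case_prod \<phi> \<in> borel_measurable (count_space UNIV \<Otimes>\<^sub>M count_space UNIV)"
    by (subst pair_measure_countable) auto
  from measurable_compose[OF measurable_Pair[OF assms] this] show ?thesis by simp
qed

lemma exchange:
  fixes \<phi> :: "int \<Rightarrow> int \<Rightarrow> real"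
  shows "integrable M (\<lambda>\<omega>. \<phi> (W \<omega>) (W' \<omega>)) \<longleftrightarrow> integrable M (\<lambda>\<omega>. \<phi> (W' \<omega>) (W \<omega>))"
    and "expectation (\<lambda>\<omega>. \<phi> (W \<omega>) (W' \<omega>)) = expectation (\<lambda>\<omega>. \<phi> (W' \<omega>) (W \<omega>))"
proof -
  let ?N = "count_space UNIV \<Otimes>\<^sub>M count_space UNIV :: (int \<times> int) measure"
  have \<phi>: "case_prod \<phi> \<in> borel_measurable ?N" by (subst pair_measure_countable) auto
  have d: "distr M ?N (\<lambda>\<omega>. (W \<omega>, W' \<omega>)) = distr M ?N (\<lambda>\<omega>. (W' \<omega>, W \<omega>))"
    using exch by (simp add: exchangeable_def)
  have m: "(\<lambda>\<omega>. (W \<omega>, W' \<omega>)) \<in> measurable M ?N" "(\<lambda>\<omega>. (W' \<omega>, W \<omega>)) \<in> measurable M ?N"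
    by measurable
  show "integrable M (\<lambda>\<omega>. \<phi> (W \<omega>) (W' \<omega>)) \<longleftrightarrow> integrable M (\<lambda>\<omega>. \<phi> (W' \<omega>) (W \<omega>))"
    using integrable_distr_eq[OF m(1) \<phi>] integrable_distr_eq[OF m(2) \<phi>] d by simp
  show "expectation (\<lambda>\<omega>. \<phi> (W \<omega>) (W' \<omega>)) = expectation (\<lambda>\<omega>. \<phi> (W' \<omega>) (W \<omega>))"
    using integral_distr[OF m(1) \<phi>] integral_distr[OF m(2) \<phi>] d by simp
qed

lemma integrable_W: "integrable M (\<lambda>\<omega>. real_of_int (W \<omega>))"
  by (rule square_integrable_imp_integrable[OF _ square_integrable_W]) simp

lemma integrable_centred_W_square: "integrable M (\<lambda>\<omega>. (real_of_int (W \<omega>) - \<mu>)\<^sup>2)"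
  using integrable_W square_integrable_W by (simp add: power2_diff)

lemma expectation_centred_W_square: "expectation (\<lambda>\<omega>. (real_of_int (W \<omega>) - \<mu>)\<^sup>2) = \<sigma>\<^sup>2"
  using variance_W by (simp add: mean_W)

lemma up_measurable [measurable]: "up \<in> borel_measurable M"
  using measurable_of_pair[OF W_meas W'_meas, of "\<lambda>a b. if b = a + 1 then 1 else 0"]
  by (rule measurable_cong[THEN iffD1, rotated]) (auto simp: indicator_def)

lemma integrable_bounded_mult:
  fixes X Y :: "'a \<Rightarrow> real"
  assumes "integrable M X" "Y \<in> borel_measurable M" "AE \<omega> in M. \<bar>Y \<omega>\<bar> \<le> c"
  shows "integrable M (\<lambda>\<omega>. X \<omega> * Y \<omega>)"
proof (rule Bochner_Integration.integrable_bound[where f = "\<lambda>\<omega>. c * X \<omega>"])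
  show "integrable M (\<lambda>\<omega>. c * X \<omega>)" using assms by simp
  have "X \<in> borel_measurable M" using assms by simp
  thus "(\<lambda>\<omega>. X \<omega> * Y \<omega>) \<in> borel_measurable M" using assms by measurable
  show "AE \<omega> in M. norm (X \<omega> * Y \<omega>) \<le> norm (c * X \<omega>)"
    using assms(3)
  proof eventually_elim
    case (elim \<omega>)
    hence "\<bar>Y \<omega>\<bar> \<le> \<bar>c\<bar>" by simp
    from mult_right_mono[OF this abs_ge_zero[of "X \<omega>"]] show ?case
      by (simp add: abs_mult mult.commute)
  qed
qed

lemma S_eq: "S = real_cond_exp M F up"
  by (simp add: cond_prob_given_def cond_exp_given_def)

lemma S_measurable [measurable]: "S \<in> borel_measurable M"
  by (simp add: S_eq)

lemma abs_S_le: "AE \<omega> in M. \<bar>S \<omega>\<bar> \<le> 1"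
proof -
  have "integrable M up" by (rule integrable_const_bound[where B = 1]) (auto simp: indicator_def)
  hence "AE \<omega> in M. 0 \<le> S \<omega>" "AE \<omega> in M. S \<omega> \<le> 1"
    unfolding S_eq by (auto intro!: cond.real_cond_exp_ge_c cond.real_cond_exp_le_c simp: indicator_def)
  thus ?thesis by eventually_elim simp
qed

lemma expectation_mult_S:
  assumes "integrable M (\<lambda>\<omega>. h (W \<omega>))"
  shows "expectation (\<lambda>\<omega>. h (W \<omega>) * S \<omega>) = expectation (\<lambda>\<omega>. h (W \<omega>) * up \<omega>)"
  unfolding S_eq
  by (intro cond.real_cond_exp_intg(2) measurable_of_W_F up_measurable
      integrable_bounded_mult[where c = 1] assms) (auto simp: indicator_def)

text \<open>
  By exchangeability the pairs with W' = W - 1, weighted by g(W), have the same total weight as the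
  pairs with W' = W + 1, weighted by g(W') = g(W + 1).
\<close>

lemma expectation_increment:
  fixes g :: "int \<Rightarrow> real"
  assumes g: "integrable M (\<lambda>\<omega>. g (W \<omega>))"
  shows "expectation (\<lambda>\<omega>. g (W \<omega>) * real_of_int (W' \<omega> - W \<omega>))
      = - expectation (\<lambda>\<omega>. (g (W \<omega> + 1) - g (W \<omega>)) * up \<omega>)"
proof -
  define u d where "u = (\<lambda>a b. if b = a + 1 then g a else 0)"
    and "d = (\<lambda>a b. if a = b + 1 then g a else 0)"
  have u_eq: "u (W \<omega>) (W' \<omega>) = g (W \<omega>) * up \<omega>" if "\<omega> \<in> space M" for \<omega>
    using that by (auto simp: u_def)
  have d_eq: "d (W' \<omega>) (W \<omega>) = g (W \<omega> + 1) * up \<omega>" if "\<omega> \<in> space M" for \<omega>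
    using that by (auto simp: d_def)
  have ind: "integrable M (\<lambda>\<omega>. u (W \<omega>) (W' \<omega>))" "integrable M (\<lambda>\<omega>. d (W \<omega>) (W' \<omega>))"
    by (rule Bochner_Integration.integrable_bound[OF g]; simp add: u_def d_def)+
  have d': "integrable M (\<lambda>\<omega>. d (W' \<omega>) (W \<omega>))" using ind(2) exchange(1)[of d] by simp
  have iu: "integrable M (\<lambda>\<omega>. g (W \<omega>) * up \<omega>)"
    using ind(1) by (subst (asm) Bochner_Integration.integrable_cong[OF refl u_eq])
  have id: "integrable M (\<lambda>\<omega>. g (W \<omega> + 1) * up \<omega>)"
    using d' by (subst (asm) Bochner_Integration.integrable_cong[OF refl d_eq])
  have "expectation (\<lambda>\<omega>. g (W \<omega>) * real_of_int (W' \<omega> - W \<omega>))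
      = expectation (\<lambda>\<omega>. u (W \<omega>) (W' \<omega>) - d (W \<omega>) (W' \<omega>))"
  proof (rule integral_cong_AE)
    show "AE \<omega> in M. g (W \<omega>) * real_of_int (W' \<omega> - W \<omega>) = u (W \<omega>) (W' \<omega>) - d (W \<omega>) (W' \<omega>)"
      using step by eventually_elim (auto simp: u_def d_def algebra_simps)
  qed measurable
  also have "\<dots> = expectation (\<lambda>\<omega>. u (W \<omega>) (W' \<omega>)) - expectation (\<lambda>\<omega>. d (W' \<omega>) (W \<omega>))"
    using ind by (simp add: exchange(2)[of d])
  also have "\<dots> = expectation (\<lambda>\<omega>. g (W \<omega>) * up \<omega>) - expectation (\<lambda>\<omega>. g (W \<omega> + 1) * up \<omega>)"
    by (simp add: u_eq d_eq cong: Bochner_Integration.integral_cong)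
  also have "\<dots> = - expectation (\<lambda>\<omega>. (g (W \<omega> + 1) - g (W \<omega>)) * up \<omega>)"
    using iu id by (simp add: left_diff_distrib)
  finally show "expectation (\<lambda>\<omega>. g (W \<omega>) * real_of_int (W' \<omega> - W \<omega>))
      = - expectation (\<lambda>\<omega>. (g (W \<omega> + 1) - g (W \<omega>)) * up \<omega>)" .
qed

text \<open>
  The remainder R differs from \<lambda> (W - \<mu>) by the drift, which is bounded by the step size. This is
  what makes R square integrable, and it reduces integrals of h(W) R to integrals of h(W) (W' - W).
\<close>

definition drift :: "'a \<Rightarrow> real" where
  "drift = real_cond_exp M F (\<lambda>\<omega>. real_of_int (W' \<omega> - W \<omega>))"

lemma drift_measurable [measurable]: "drift \<in> borel_measurable M"
  by (simp add: drift_def)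

lemma increment_measurable [measurable]: "(\<lambda>\<omega>. real_of_int (W' \<omega> - W \<omega>)) \<in> borel_measurable M"
  by (rule measurable_of_pair[OF W_meas W'_meas])

lemma abs_increment_le: "AE \<omega> in M. \<bar>real_of_int (W' \<omega> - W \<omega>)\<bar> \<le> 1"
  using step by eventually_elim auto

lemma integrable_increment: "integrable M (\<lambda>\<omega>. real_of_int (W' \<omega> - W \<omega>))"
  by (rule integrable_const_bound[where B = 1]) (use abs_increment_le in auto)

lemma abs_drift_le: "AE \<omega> in M. \<bar>drift \<omega>\<bar> \<le> 1"
proof -
  have "AE \<omega> in M. -1 \<le> real_of_int (W' \<omega> - W \<omega>)" "AE \<omega> in M. real_of_int (W' \<omega> - W \<omega>) \<le> 1"
    using abs_increment_le by (eventually_elim, simp)+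
  from cond.real_cond_exp_ge_c[OF integrable_increment this(1)]
    cond.real_cond_exp_le_c[OF integrable_increment this(2)]
  have "AE \<omega> in M. -1 \<le> drift \<omega>" "AE \<omega> in M. drift \<omega> \<le> 1"
    by (simp_all only: drift_def)
  thus ?thesis by eventually_elim simp
qed

lemma R_eq: "AE \<omega> in M. R \<omega> = drift \<omega> + lam * (real_of_int (W \<omega>) - \<mu>)"
proof -
  have c: "integrable M (\<lambda>\<omega>. real_of_int (W \<omega>) - \<mu>)" using integrable_W by simp
  have "AE \<omega> in M. real_cond_exp M F (\<lambda>\<omega>. real_of_int (W' \<omega> - W \<omega>) + (real_of_int (W \<omega>) - \<mu>)) \<omega>
      = drift \<omega> + real_cond_exp M F (\<lambda>\<omega>. real_of_int (W \<omega>) - \<mu>) \<omega>"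
    unfolding drift_def by (intro cond.real_cond_exp_add integrable_increment c)
  moreover have "AE \<omega> in M. real_cond_exp M F (\<lambda>\<omega>. real_of_int (W \<omega>) - \<mu>) \<omega> = real_of_int (W \<omega>) - \<mu>"
    by (intro cond.real_cond_exp_F_meas c measurable_of_W_F)
  ultimately show ?thesis
    using regression by eventually_elim (simp add: cond_exp_given_def algebra_simps)
qed

lemma expectation_mult_R:
  fixes h :: "int \<Rightarrow> real"
  assumes h: "integrable M (\<lambda>\<omega>. h (W \<omega>))" "integrable M (\<lambda>\<omega>. (real_of_int (W \<omega>) - \<mu>) * h (W \<omega>))"
  shows "expectation (\<lambda>\<omega>. h (W \<omega>) * R \<omega>)
      = expectation (\<lambda>\<omega>. h (W \<omega>) * real_of_int (W' \<omega> - W \<omega>))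
        + lam * expectation (\<lambda>\<omega>. (real_of_int (W \<omega>) - \<mu>) * h (W \<omega>))"
proof -
  have 1: "integrable M (\<lambda>\<omega>. h (W \<omega>) * drift \<omega>)"
      "expectation (\<lambda>\<omega>. h (W \<omega>) * drift \<omega>) = expectation (\<lambda>\<omega>. h (W \<omega>) * real_of_int (W' \<omega> - W \<omega>))"
    unfolding drift_def
    by (intro cond.real_cond_exp_intg measurable_of_W_F increment_measurable
        integrable_bounded_mult[OF h(1) _ abs_increment_le])+
  let ?f = "\<lambda>\<omega>. h (W \<omega>) * drift \<omega> + lam * ((real_of_int (W \<omega>) - \<mu>) * h (W \<omega>))"
  have ae: "AE \<omega> in M. h (W \<omega>) * R \<omega> = ?f \<omega>"
    using R_eq
  proof eventually_elim
    case (elim \<omega>)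
    show ?case unfolding elim by (simp add: algebra_simps)
  qed
  have "expectation (\<lambda>\<omega>. h (W \<omega>) * R \<omega>) = expectation ?f"
    by (rule integral_cong_AE[OF _ _ ae]) measurable
  also have "\<dots> = expectation (\<lambda>\<omega>. h (W \<omega>) * drift \<omega>)
        + lam * expectation (\<lambda>\<omega>. (real_of_int (W \<omega>) - \<mu>) * h (W \<omega>))"
    using 1(1) h by simp
  finally show "expectation (\<lambda>\<omega>. h (W \<omega>) * R \<omega>)
      = expectation (\<lambda>\<omega>. h (W \<omega>) * real_of_int (W' \<omega> - W \<omega>))
        + lam * expectation (\<lambda>\<omega>. (real_of_int (W \<omega>) - \<mu>) * h (W \<omega>))"
    by (simp add: 1(2))
qed

lemma square_integrable_R: "integrable M (\<lambda>\<omega>. (R \<omega>)\<^sup>2)"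
proof (rule Bochner_Integration.integrable_bound)
  show "integrable M (\<lambda>\<omega>. 2 + 2 * lam\<^sup>2 * (real_of_int (W \<omega>) - \<mu>)\<^sup>2)"
    using integrable_centred_W_square by simp
  show "AE \<omega> in M. norm ((R \<omega>)\<^sup>2) \<le> norm (2 + 2 * lam\<^sup>2 * (real_of_int (W \<omega>) - \<mu>)\<^sup>2)"
    using R_eq abs_drift_le
  proof eventually_elim
    case (elim \<omega>)
    let ?x = "lam * (real_of_int (W \<omega>) - \<mu>)"
    have "(drift \<omega> + ?x)\<^sup>2 \<le> 2 * (drift \<omega>)\<^sup>2 + 2 * ?x\<^sup>2"
      using sum_squares_bound[of "drift \<omega>" ?x] by (simp add: power2_sum)
    also have "\<dots> \<le> 2 + 2 * ?x\<^sup>2" using elim(2) by (simp add: abs_square_le_1)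
    finally show ?case using elim(1) by (simp add: power_mult_distrib)
  qed
qed measurable

lemma expectation_R: "expectation R = 0"
proof -
  have c: "integrable M (\<lambda>\<omega>. (real_of_int (W \<omega>) - \<mu>) * 1)" using integrable_W by simp
  have "expectation R = expectation (\<lambda>\<omega>. real_of_int (W' \<omega> - W \<omega>))
      + lam * expectation (\<lambda>\<omega>. real_of_int (W \<omega>) - \<mu>)"
    using expectation_mult_R[of "\<lambda>_. 1", OF _ c] by simp
  also have "expectation (\<lambda>\<omega>. real_of_int (W' \<omega> - W \<omega>)) = 0"
    using expectation_increment[of "\<lambda>_. 1"] by simp
  also have "expectation (\<lambda>\<omega>. real_of_int (W \<omega>) - \<mu>) = 0"
    using integrable_W by (simp add: mean_W prob_space)
  finally show ?thesis by simp
qed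

text \<open>The case h(w) = w - \<mu> of \<open>expectation_increment\<close>, where the forward difference is 1.\<close>

lemma expectation_S: "expectation S = lam * \<sigma>\<^sup>2 - expectation (\<lambda>\<omega>. (real_of_int (W \<omega>) - \<mu>) * R \<omega>)"
proof -
  have c: "integrable M (\<lambda>\<omega>. real_of_int (W \<omega>) - \<mu>)" using integrable_W by simp
  have "expectation (\<lambda>\<omega>. (real_of_int (W \<omega>) - \<mu>) * R \<omega>)
      = expectation (\<lambda>\<omega>. (real_of_int (W \<omega>) - \<mu>) * real_of_int (W' \<omega> - W \<omega>)) + lam * \<sigma>\<^sup>2"
    using expectation_mult_R[of "\<lambda>w. real_of_int w - \<mu>"] c integrable_centred_W_square
    by (simp flip: power2_eq_square expectation_centred_W_square)
  also have "expectation (\<lambda>\<omega>. (real_of_int (W \<omega>) - \<mu>) * real_of_int (W' \<omega> - W \<omega>)) = - expectation up"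
    using expectation_increment[of "\<lambda>w. real_of_int w - \<mu>", OF c] by simp
  also have "expectation up = expectation S"
    using expectation_mult_S[of "\<lambda>_. 1"] by simp
  finally show ?thesis by simp
qed

end

context exchangeable_regression
begin

lemma prob_W_le_q_max: "prob {\<omega> \<in> space M. W \<omega> = k} \<le> q_max M W"
  unfolding q_max_def by (intro cSUP_upper bdd_aboveI[where M = 1]) auto

lemma q_max_nonneg: "0 \<le> q_max M W"
  using prob_W_le_q_max[of 0] measure_nonneg order_trans by blast

text \<open>
  The expectation is the series of \<phi> k against point probabilities of W; it is reached by dominated
  convergence from its partial sums, each of which is at most q_max times a partial sum of \<phi>.
\<close>

lemma expectation_le_q_max_sum:
  fixes \<phi> :: "nat \<Rightarrow> real" and s :: int
  assumes nonneg: "\<And>k. 0 \<le> \<phi> k" and sum: "\<And>n. (\<Sum>k<n. \<phi> k) \<le> V"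
  shows "expectation (\<lambda>\<omega>. if s \<le> W \<omega> then \<phi> (nat (W \<omega> - s)) else 0) \<le> q_max M W * V"
proof -
  define f where "f w = (if s \<le> w then \<phi> (nat (w - s)) else 0)" for w
  define t where "t n w = (if w < s + int n then f w else 0)" for n w
  have le_V: "\<phi> k \<le> V" for k
    using sum[of "Suc k"] sum_nonneg[of "{..<k}" \<phi>] nonneg by simp
  have f_bound: "\<bar>f w\<bar> \<le> V" for w
    using nonneg le_V order_trans[OF nonneg[of 0] le_V] by (auto simp: f_def)
  have lim: "(\<lambda>n. expectation (\<lambda>\<omega>. t n (W \<omega>))) \<longlonglongrightarrow> expectation (\<lambda>\<omega>. f (W \<omega>))"
  proof (rule integral_dominated_convergence[where w = "\<lambda>_. V"])
    show "AE \<omega> in M. (\<lambda>n. t n (W \<omega>)) \<longlonglongrightarrow> f (W \<omega>)"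
    proof (rule AE_I2, rule tendsto_eventually)
      fix \<omega>
      show "\<forall>\<^sub>F n in sequentially. t n (W \<omega>) = f (W \<omega>)"
        using eventually_gt_at_top[of "nat (W \<omega> - s)"]
        by eventually_elim (auto simp: t_def)
    qed
    show "AE \<omega> in M. norm (t n (W \<omega>)) \<le> V" for n
      using f_bound order_trans[OF abs_ge_zero f_bound] by (auto simp: t_def)
  qed (auto intro: measurable_of_W)
  have "expectation (\<lambda>\<omega>. t n (W \<omega>)) \<le> q_max M W * V" for n
  proof -
    have t_eq: "t n (W \<omega>) = (\<Sum>k<n. \<phi> k * indicator {\<omega> \<in> space M. W \<omega> = s + int k} \<omega>)"
      if "\<omega> \<in> space M" for \<omega>
    proof (cases "s \<le> W \<omega> \<and> W \<omega> < s + int n")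
      case True
      hence "(\<Sum>k<n. \<phi> k * indicator {\<omega> \<in> space M. W \<omega> = s + int k} \<omega>)
          = (\<Sum>k\<in>{nat (W \<omega> - s)}. \<phi> k * indicator {\<omega> \<in> space M. W \<omega> = s + int k} \<omega>)"
        by (intro sum.mono_neutral_right) (auto simp: indicator_def split: if_splits)
      thus ?thesis using True that by (simp add: t_def f_def)
    next
      case False
      thus ?thesis using that by (auto simp: t_def f_def intro!: sum.neutral)
    qed
    have ev: "{\<omega> \<in> space M. W \<omega> = s + int k} \<in> events" for k by measurable
    have "expectation (\<lambda>\<omega>. t n (W \<omega>))
        = expectation (\<lambda>\<omega>. \<Sum>k<n. \<phi> k * indicator {\<omega> \<in> space M. W \<omega> = s + int k} \<omega>)"
      by (intro Bochner_Integration.integral_cong t_eq) auto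
    also have "\<dots> = (\<Sum>k<n. \<phi> k * prob {\<omega> \<in> space M. W \<omega> = s + int k})"
      using ev by (subst Bochner_Integration.integral_sum) (auto simp: emeasure_eq_measure)
    also have "\<dots> \<le> (\<Sum>k<n. \<phi> k * q_max M W)"
      by (intro sum_mono mult_left_mono prob_W_le_q_max nonneg)
    also have "\<dots> = q_max M W * (\<Sum>k<n. \<phi> k)"
      by (simp add: sum_distrib_left mult.commute)
    also have "\<dots> \<le> q_max M W * V"
      by (intro mult_left_mono sum q_max_nonneg)
    finally show ?thesis .
  qed
  hence "expectation (\<lambda>\<omega>. f (W \<omega>)) \<le> q_max M W * V"
    by (intro LIMSEQ_le_const2[OF lim]) auto
  thus ?thesis by (simp add: f_def)
qed

text \<open>
  Expanding E[R g] by the regression property leaves E[S \<Delta>]; splitting off the mean of S and inserting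
  its value from \<open>expectation_S\<close> turns it into a covariance and cancels the main term \<lambda> \<sigma>^2 E[\<Delta>].
\<close>

lemma stein_identity:
  fixes g :: "int \<Rightarrow> real"
  assumes bound: "\<And>w. \<bar>g w\<bar> \<le> c"
  defines "\<Delta> \<equiv> \<lambda>w. g (w + 1) - g w"
  shows "lam * (\<sigma>\<^sup>2 * expectation (\<lambda>\<omega>. \<Delta> (W \<omega>)) - expectation (\<lambda>\<omega>. (real_of_int (W \<omega>) - \<mu>) * g (W \<omega>)))
    = expectation (\<lambda>\<omega>. (real_of_int (W \<omega>) - \<mu>) * R \<omega>) * expectation (\<lambda>\<omega>. \<Delta> (W \<omega>))
      - expectation (\<lambda>\<omega>. (S \<omega> - expectation S) * \<Delta> (W \<omega>))
      - expectation (\<lambda>\<omega>. g (W \<omega>) * R \<omega>)"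
proof -
  have g: "integrable M (\<lambda>\<omega>. g (W \<omega>))" "integrable M (\<lambda>\<omega>. g (W \<omega> + 1))"
    using measurable_of_W[of g] measurable_of_W[of "\<lambda>w. g (w + 1)"] bound
    by (auto intro!: integrable_const_bound[where B = c])
  have \<Delta>: "integrable M (\<lambda>\<omega>. \<Delta> (W \<omega>))" using g by (simp add: \<Delta>_def)
  have S\<Delta>: "integrable M (\<lambda>\<omega>. \<Delta> (W \<omega>) * S \<omega>)"
    by (rule integrable_bounded_mult[OF \<Delta> S_measurable abs_S_le])
  have "integrable M (\<lambda>\<omega>. (real_of_int (W \<omega>) - \<mu>) * g (W \<omega>))"
    using integrable_W measurable_of_W[of g] bound
    by (intro integrable_bounded_mult[where c = c]) auto
  from expectation_mult_R[OF g(1) this]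
  have "expectation (\<lambda>\<omega>. g (W \<omega>) * R \<omega>) = - expectation (\<lambda>\<omega>. \<Delta> (W \<omega>) * S \<omega>)
      + lam * expectation (\<lambda>\<omega>. (real_of_int (W \<omega>) - \<mu>) * g (W \<omega>))"
    using expectation_increment[OF g(1)] expectation_mult_S[OF \<Delta>] by (simp add: \<Delta>_def)
  moreover have "expectation (\<lambda>\<omega>. (S \<omega> - expectation S) * \<Delta> (W \<omega>))
      = expectation (\<lambda>\<omega>. \<Delta> (W \<omega>) * S \<omega>) - expectation S * expectation (\<lambda>\<omega>. \<Delta> (W \<omega>))"
  proof -
    have "expectation (\<lambda>\<omega>. (S \<omega> - expectation S) * \<Delta> (W \<omega>))
        = expectation (\<lambda>\<omega>. \<Delta> (W \<omega>) * S \<omega> - expectation S * \<Delta> (W \<omega>))"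
      by (simp add: algebra_simps)
    also have "\<dots> = expectation (\<lambda>\<omega>. \<Delta> (W \<omega>) * S \<omega>) - expectation S * expectation (\<lambda>\<omega>. \<Delta> (W \<omega>))"
      using \<Delta> S\<Delta> by (subst Bochner_Integration.integral_diff) auto
    finally show ?thesis .
  qed
  moreover have "lam * \<sigma>\<^sup>2 = expectation S + expectation (\<lambda>\<omega>. (real_of_int (W \<omega>) - \<mu>) * R \<omega>)"
    by (simp add: expectation_S)
  ultimately show ?thesis
    by (simp add: right_diff_distrib distrib_right flip: mult.assoc)
qed

lemma stein_identity_bound:
  fixes g :: "int \<Rightarrow> real"
  assumes bound: "\<And>w. \<bar>g w\<bar> \<le> c"
  defines "\<Delta> \<equiv> \<lambda>w. g (w + 1) - g w"
  assumes a: "\<bar>expectation (\<lambda>\<omega>. \<Delta> (W \<omega>))\<bar> \<le> a"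
    and b: "sqrt (expectation (\<lambda>\<omega>. (\<Delta> (W \<omega>))\<^sup>2)) \<le> b"
  shows "\<bar>\<sigma>\<^sup>2 * expectation (\<lambda>\<omega>. \<Delta> (W \<omega>)) - expectation (\<lambda>\<omega>. (real_of_int (W \<omega>) - \<mu>) * g (W \<omega>))\<bar>
    \<le> (sqrt (variance S) * b + \<sigma> * sqrt (variance R) * a + sqrt (variance R) * c) / lam"
    (is "\<bar>?D\<bar> \<le> _")
proof -
  have \<Delta>_bound: "\<bar>\<Delta> w\<bar> \<le> 2 * c" for w
    using bound[of w] bound[of "w + 1"] by (simp add: \<Delta>_def)
  have sq: "(x::real)\<^sup>2 \<le> d\<^sup>2" if "\<bar>x\<bar> \<le> d" for x d
    using that by (rule power2_le_iff_abs_le[THEN iffD2, rotated]) (use that abs_ge_zero order_trans in blast)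
  have g2: "integrable M (\<lambda>\<omega>. (g (W \<omega>))\<^sup>2)"
    using measurable_of_W[of "\<lambda>w. (g w)\<^sup>2"] sq[OF bound]
    by (intro integrable_const_bound[where B = "c\<^sup>2"]) auto
  have \<Delta>2: "integrable M (\<lambda>\<omega>. (\<Delta> (W \<omega>))\<^sup>2)"
    using measurable_of_W[of "\<lambda>w. (\<Delta> w)\<^sup>2"] sq[OF \<Delta>_bound]
    by (intro integrable_const_bound[where B = "(2 * c)\<^sup>2"]) auto
  have S2: "integrable M (\<lambda>\<omega>. (S \<omega> - expectation S)\<^sup>2)"
  proof (rule integrable_const_bound[where B = "(1 + \<bar>expectation S\<bar>)\<^sup>2"])
    show "AE \<omega> in M. norm ((S \<omega> - expectation S)\<^sup>2) \<le> (1 + \<bar>expectation S\<bar>)\<^sup>2"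
      using abs_S_le
    proof eventually_elim
      case (elim \<omega>)
      hence "\<bar>S \<omega> - expectation S\<bar> \<le> 1 + \<bar>expectation S\<bar>" by linarith
      from sq[OF this] show ?case by simp
    qed
  qed measurable
  have varR: "variance R = expectation (\<lambda>\<omega>. (R \<omega>)\<^sup>2)" by (simp add: expectation_R)
  have WR: "\<bar>expectation (\<lambda>\<omega>. (real_of_int (W \<omega>) - \<mu>) * R \<omega>)\<bar> \<le> \<sigma> * sqrt (variance R)"
    using Cauchy_Schwarz_integral(2)[of "\<lambda>\<omega>. real_of_int (W \<omega>) - \<mu>" M R]
      integrable_centred_W_square square_integrable_R sigma_pos
    by (simp add: expectation_centred_W_square varR)
  have "\<bar>expectation (\<lambda>\<omega>. (S \<omega> - expectation S) * \<Delta> (W \<omega>))\<bar>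
      \<le> sqrt (variance S) * sqrt (expectation (\<lambda>\<omega>. (\<Delta> (W \<omega>))\<^sup>2))"
    using S2 \<Delta>2 measurable_of_W[of \<Delta>] by (intro Cauchy_Schwarz_integral) auto
  also have "\<dots> \<le> sqrt (variance S) * b"
    using b by (intro mult_left_mono) auto
  finally have S\<Delta>: "\<bar>expectation (\<lambda>\<omega>. (S \<omega> - expectation S) * \<Delta> (W \<omega>))\<bar> \<le> sqrt (variance S) * b" .
  have "\<bar>expectation (\<lambda>\<omega>. g (W \<omega>) * R \<omega>)\<bar>
      \<le> sqrt (expectation (\<lambda>\<omega>. (g (W \<omega>))\<^sup>2)) * sqrt (variance R)"
    unfolding varR using g2 square_integrable_R measurable_of_W[of g]
    by (intro Cauchy_Schwarz_integral) auto
  also have "\<dots> \<le> c * sqrt (variance R)"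
  proof (intro mult_right_mono real_le_lsqrt)
    have "expectation (\<lambda>\<omega>. (g (W \<omega>))\<^sup>2) \<le> expectation (\<lambda>\<omega>. c\<^sup>2)"
      using g2 sq[OF bound] by (intro integral_mono) auto
    thus "expectation (\<lambda>\<omega>. (g (W \<omega>))\<^sup>2) \<le> c\<^sup>2" by (simp add: prob_space)
    show "0 \<le> c" using bound[of 0] by simp
  qed auto
  finally have gR: "\<bar>expectation (\<lambda>\<omega>. g (W \<omega>) * R \<omega>)\<bar> \<le> c * sqrt (variance R)" .
  have "\<bar>expectation (\<lambda>\<omega>. (real_of_int (W \<omega>) - \<mu>) * R \<omega>) * expectation (\<lambda>\<omega>. \<Delta> (W \<omega>))\<bar>
      \<le> \<sigma> * sqrt (variance R) * a"
    unfolding abs_mult using WR a sigma_pos by (intro mult_mono) auto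
  with S\<Delta> gR have "\<bar>lam * ?D\<bar> \<le> sqrt (variance S) * b + \<sigma> * sqrt (variance R) * a + sqrt (variance R) * c"
    using stein_identity[of g c, OF bound] by (simp add: \<Delta>_def mult.commute[of c])
  thus ?thesis using lam_pos by (simp add: abs_mult pos_le_divide_eq mult.commute)
qed

section \<open>Comparison with the translated Poisson distribution\<close>

definition shift :: int where "shift = \<lfloor>\<mu> - \<sigma>\<^sup>2\<rfloor>"

definition rate :: real where "rate = \<sigma>\<^sup>2 + frac (\<mu> - \<sigma>\<^sup>2)"

lemma shift_add_rate: "real_of_int shift + rate = \<mu>"
  by (simp add: shift_def rate_def frac_def)

lemma rate_ge: "\<sigma>\<^sup>2 \<le> rate" and rate_le: "rate \<le> \<sigma>\<^sup>2 + 1"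
  using frac_ge_0[of "\<mu> - \<sigma>\<^sup>2"] frac_lt_1[of "\<mu> - \<sigma>\<^sup>2"] by (auto simp: rate_def)

lemma rate_pos: "0 < rate"
  using rate_ge sigma_pos zero_less_power[of \<sigma> 2] by linarith

lemma measure_TP:
  "measure (TP \<mu> (\<sigma>\<^sup>2)) A = pois_prob rate {n. int n + shift \<in> A}"
  by (simp add: TP_eq measure_map_pmf shift_def rate_def vimage_def)

text \<open>
  Below the shift, W is smaller than its mean by more than rate \<ge> \<sigma>^2, a deviation of \<sigma> standard
  deviations.
\<close>

lemma prob_below_shift: "prob {\<omega> \<in> space M. W \<omega> < shift} \<le> 1 / \<sigma>\<^sup>2"
proof -
  have "prob {\<omega> \<in> space M. W \<omega> < shift} \<le> prob {\<omega> \<in> space M. \<sigma>\<^sup>2 \<le> \<bar>real_of_int (W \<omega>) - \<mu>\<bar>}"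
  proof (rule finite_measure_mono)
    show "{\<omega> \<in> space M. W \<omega> < shift} \<subseteq> {\<omega> \<in> space M. \<sigma>\<^sup>2 \<le> \<bar>real_of_int (W \<omega>) - \<mu>\<bar>}"
    proof safe
      fix \<omega> assume "W \<omega> < shift"
      hence "real_of_int (W \<omega>) < real_of_int shift" by simp
      thus "\<sigma>\<^sup>2 \<le> \<bar>real_of_int (W \<omega>) - \<mu>\<bar>" using shift_add_rate rate_ge by linarith
    qed
  qed measurable
  also have "\<dots> \<le> \<sigma>\<^sup>2 / (\<sigma>\<^sup>2)\<^sup>2"
    using Chebyshev_inequality[of "\<lambda>\<omega>. real_of_int (W \<omega>)" "\<sigma>\<^sup>2"] square_integrable_W sigma_pos variance_W
    by (simp add: mean_W)
  also have "\<dots> = 1 / \<sigma>\<^sup>2" using sigma_pos by (simp add: power2_eq_square)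
  finally show ?thesis .
qed

definition stein_W :: "nat set \<Rightarrow> int \<Rightarrow> real" where
  "stein_W B w = stein_solution rate B (nat (w - shift))"

lemma stein_W_diff:
  "stein_W B (w + 1) - stein_W B w =
     (if shift \<le> w then stein_solution rate B (Suc (nat (w - shift))) - stein_solution rate B (nat (w - shift)) else 0)"
proof (cases "shift \<le> w")
  case True
  hence "nat (w + 1 - shift) = Suc (nat (w - shift))" by simp
  thus ?thesis using True by (simp add: stein_W_def)
qed (simp add: stein_W_def)

lemma abs_stein_W_diff_le: "\<bar>stein_W B (w + 1) - stein_W B w\<bar> \<le> 1 / rate"
  using abs_stein_diff_le[OF rate_pos] rate_pos by (simp add: stein_W_diff)

text \<open>
  The Stein equation integrated against the law of W. One 1/\<sigma>^2 pays for the values of W below the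
  shift, where g vanishes and solves nothing; the other for the difference between rate and \<sigma>^2.
\<close>

lemma abs_law_diff_TP_le:
  defines "\<Delta> \<equiv> \<lambda>B w. stein_W B (w + 1) - stein_W B w"
  assumes B: "B = {n. int n + shift \<in> A}"
    and c: "\<And>n. \<bar>stein_solution rate B n\<bar> \<le> c"
    and a: "\<bar>expectation (\<lambda>\<omega>. \<Delta> B (W \<omega>))\<bar> \<le> a"
    and b: "sqrt (expectation (\<lambda>\<omega>. (\<Delta> B (W \<omega>))\<^sup>2)) \<le> b"
  shows "\<bar>measure (law M W) A - measure (TP \<mu> (\<sigma>\<^sup>2)) A\<bar>
    \<le> (sqrt (variance S) * b + \<sigma> * sqrt (variance R) * a + sqrt (variance R) * c) / lam + 2 / \<sigma>\<^sup>2"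
proof -
  let ?P = "pois_prob rate B"
  let ?g = "stein_W B"
  define r where "r w = (if w < shift then indicator A w - ?P else 0)" for w
  have g_bound: "\<bar>?g w\<bar> \<le> c" for w by (simp add: stein_W_def c)
  have pointwise: "indicator A w - ?P = rate * \<Delta> B w - (real_of_int w - \<mu>) * ?g w + r w" for w
  proof (cases "shift \<le> w")
    case True
    define k where "k = nat (w - shift)"
    have w: "w = int k + shift" using True by (simp add: k_def)
    have "nat (w + 1 - shift) = Suc k" by (simp add: w)
    moreover have "indicator A w = (indicator B k :: real)" by (simp add: w B indicator_def)
    ultimately have "indicator A w - ?P = rate * ?g (w + 1) - real k * ?g w"
      using stein_equation[OF rate_pos, of B k] by (simp add: stein_W_def k_def)
    moreover have "real k = real_of_int w - \<mu> + rate" using shift_add_rate by (simp add: w)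
    ultimately show ?thesis using True by (simp add: \<Delta>_def r_def algebra_simps)
  next
    case False
    thus ?thesis by (simp add: \<Delta>_def r_def stein_W_diff) (simp add: stein_W_def)
  qed
  have r_le: "\<bar>r w\<bar> \<le> indicator {..<shift} w" for w
    using measure_pmf.prob_le_1[of "poisson_pmf rate" B] measure_nonneg[of "poisson_pmf rate" B]
    by (auto simp: r_def indicator_def)
  have \<Delta>_le: "\<bar>\<Delta> B w\<bar> \<le> 1 / rate" for w
    unfolding \<Delta>_def by (rule abs_stein_W_diff_le)
  have int_\<Delta>: "integrable M (\<lambda>\<omega>. \<Delta> B (W \<omega>))"
    using measurable_of_W[of "\<Delta> B"] \<Delta>_le by (intro integrable_const_bound[where B = "1 / rate"]) auto
  have int_g: "integrable M (\<lambda>\<omega>. (real_of_int (W \<omega>) - \<mu>) * ?g (W \<omega>))"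
    using integrable_W measurable_of_W[of ?g] g_bound
    by (intro integrable_bounded_mult[where c = c]) auto
  have int_r: "integrable M (\<lambda>\<omega>. r (W \<omega>))"
    using measurable_of_W[of r] order_trans[OF r_le indicator_le_1]
    by (intro integrable_const_bound[where B = 1]) auto
  have below: "{\<omega> \<in> space M. W \<omega> < shift} \<in> events" by measurable
  have "\<bar>expectation (\<lambda>\<omega>. r (W \<omega>))\<bar> \<le> expectation (\<lambda>\<omega>. \<bar>r (W \<omega>)\<bar>)"
    by (rule integral_abs_bound)
  also have "\<dots> \<le> expectation (indicator {\<omega> \<in> space M. W \<omega> < shift})"
    using int_r r_le below
    by (intro integral_mono) (auto simp: emeasure_eq_measure indicator_def split: if_splits)
  also have "\<dots> \<le> 1 / \<sigma>\<^sup>2" using prob_below_shift below by simp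
  finally have r: "\<bar>expectation (\<lambda>\<omega>. r (W \<omega>))\<bar> \<le> 1 / \<sigma>\<^sup>2" .
  have "\<bar>expectation (\<lambda>\<omega>. \<Delta> B (W \<omega>))\<bar> \<le> expectation (\<lambda>\<omega>. \<bar>\<Delta> B (W \<omega>)\<bar>)"
    by (rule integral_abs_bound)
  also have "\<dots> \<le> expectation (\<lambda>\<omega>. 1 / rate)"
    using int_\<Delta> \<Delta>_le by (intro integral_mono) auto
  also have "\<dots> \<le> 1 / \<sigma>\<^sup>2"
    using rate_ge sigma_pos by (simp add: prob_space frac_le)
  finally have "(rate - \<sigma>\<^sup>2) * \<bar>expectation (\<lambda>\<omega>. \<Delta> B (W \<omega>))\<bar> \<le> 1 * (1 / \<sigma>\<^sup>2)"
    using rate_le rate_ge by (intro mult_mono) auto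
  hence \<gamma>: "\<bar>(rate - \<sigma>\<^sup>2) * expectation (\<lambda>\<omega>. \<Delta> B (W \<omega>))\<bar> \<le> 1 / \<sigma>\<^sup>2"
    using rate_ge by (simp add: abs_mult)
  have A: "{\<omega> \<in> space M. W \<omega> \<in> A} \<in> events" by measurable
  have "measure (law M W) A = prob {\<omega> \<in> space M. W \<omega> \<in> A}"
    unfolding law_def by (subst measure_distr) (auto intro!: arg_cong[where f = prob])
  also have "\<dots> = expectation (\<lambda>\<omega>. indicator A (W \<omega>))"
  proof -
    have "expectation (\<lambda>\<omega>. indicator A (W \<omega>) :: real)
        = expectation (indicator {\<omega> \<in> space M. W \<omega> \<in> A})"
      by (intro Bochner_Integration.integral_cong) (auto simp: indicator_def)
    thus ?thesis using A by simp
  qed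
  also have "\<dots> = expectation (\<lambda>\<omega>. ?P + (rate * \<Delta> B (W \<omega>) - (real_of_int (W \<omega>) - \<mu>) * ?g (W \<omega>) + r (W \<omega>)))"
    by (simp flip: pointwise)
  also have "\<dots> = ?P + (rate * expectation (\<lambda>\<omega>. \<Delta> B (W \<omega>))
      - expectation (\<lambda>\<omega>. (real_of_int (W \<omega>) - \<mu>) * ?g (W \<omega>)) + expectation (\<lambda>\<omega>. r (W \<omega>)))"
    using int_\<Delta> int_g int_r by (simp add: prob_space)
  finally have "measure (law M W) A - measure (TP \<mu> (\<sigma>\<^sup>2)) A
      = (\<sigma>\<^sup>2 * expectation (\<lambda>\<omega>. \<Delta> B (W \<omega>)) - expectation (\<lambda>\<omega>. (real_of_int (W \<omega>) - \<mu>) * ?g (W \<omega>)))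
        + (rate - \<sigma>\<^sup>2) * expectation (\<lambda>\<omega>. \<Delta> B (W \<omega>)) + expectation (\<lambda>\<omega>. r (W \<omega>))"
    by (simp add: measure_TP B algebra_simps)
  thus ?thesis
    using stein_identity_bound[of ?g c a b, OF g_bound] a b r \<gamma> unfolding \<Delta>_def by linarith
qed

lemma d_TV_bound:
  "d_TV (law M W) (TP \<mu> (\<sigma>\<^sup>2))
     \<le> sqrt (variance S) / (lam * \<sigma>\<^sup>2) + 2 * sqrt (variance R) / (lam * \<sigma>) + 2 / \<sigma>\<^sup>2"
  unfolding d_TV_def
proof (rule cSUP_least)
  fix A :: "int set"
  define B where "B = {n. int n + shift \<in> A}"
  let ?\<Delta> = "\<lambda>w. stein_W B (w + 1) - stein_W B w"
  have inv: "1 / rate \<le> 1 / \<sigma>\<^sup>2" using rate_ge sigma_pos by (simp add: frac_le)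
  have \<Delta>: "\<bar>?\<Delta> w\<bar> \<le> 1 / \<sigma>\<^sup>2" for w
    using abs_stein_W_diff_le[of B w] inv by linarith
  have "\<sigma> = sqrt (\<sigma>\<^sup>2)" using sigma_pos by simp
  also have "\<dots> \<le> sqrt rate" using rate_ge by (rule real_sqrt_le_mono)
  finally have c: "\<bar>stein_solution rate B n\<bar> \<le> 1 / \<sigma>" for n
    using abs_stein_le[OF rate_pos, of B n] sigma_pos
    by (meson divide_left_mono mult_pos_pos order_less_le_trans order_trans zero_le_one)
  have sq: "(?\<Delta> w)\<^sup>2 \<le> (1 / \<sigma>\<^sup>2)\<^sup>2" for w
    using \<Delta>[of w] by (simp only: power2_le_iff_abs_le zero_le_divide_1_iff zero_le_power2)
  have int: "integrable M (\<lambda>\<omega>. ?\<Delta> (W \<omega>))" "integrable M (\<lambda>\<omega>. (?\<Delta> (W \<omega>))\<^sup>2)"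
    using measurable_of_W[of ?\<Delta>] measurable_of_W[of "\<lambda>w. (?\<Delta> w)\<^sup>2"] \<Delta> sq
    by (auto intro!: integrable_const_bound[where B = "1 / \<sigma>\<^sup>2"]
        integrable_const_bound[where B = "(1 / \<sigma>\<^sup>2)\<^sup>2" and f = "\<lambda>\<omega>. (?\<Delta> (W \<omega>))\<^sup>2"])
  have "\<bar>expectation (\<lambda>\<omega>. ?\<Delta> (W \<omega>))\<bar> \<le> expectation (\<lambda>\<omega>. \<bar>?\<Delta> (W \<omega>)\<bar>)"
    by (rule integral_abs_bound)
  also have "\<dots> \<le> expectation (\<lambda>\<omega>. 1 / \<sigma>\<^sup>2)"
    using int(1) \<Delta> by (intro integral_mono) auto
  finally have a: "\<bar>expectation (\<lambda>\<omega>. ?\<Delta> (W \<omega>))\<bar> \<le> 1 / \<sigma>\<^sup>2" by (simp add: prob_space)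
  have "expectation (\<lambda>\<omega>. (?\<Delta> (W \<omega>))\<^sup>2) \<le> expectation (\<lambda>\<omega>. (1 / \<sigma>\<^sup>2)\<^sup>2)"
    using int(2) sq by (intro integral_mono) auto
  hence b: "sqrt (expectation (\<lambda>\<omega>. (?\<Delta> (W \<omega>))\<^sup>2)) \<le> 1 / \<sigma>\<^sup>2"
    by (intro real_le_lsqrt) (auto simp: prob_space)
  have "(sqrt (variance S) * (1 / \<sigma>\<^sup>2) + \<sigma> * sqrt (variance R) * (1 / \<sigma>\<^sup>2) + sqrt (variance R) * (1 / \<sigma>)) / lam
      = sqrt (variance S) / (lam * \<sigma>\<^sup>2) + 2 * sqrt (variance R) / (lam * \<sigma>)"
    using sigma_pos lam_pos by (simp add: field_simps power2_eq_square)
  with abs_law_diff_TP_le[OF B_def c a b]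
  show "\<bar>measure (law M W) A - measure (TP \<mu> (\<sigma>\<^sup>2)) A\<bar>
      \<le> sqrt (variance S) / (lam * \<sigma>\<^sup>2) + 2 * sqrt (variance R) / (lam * \<sigma>) + 2 / \<sigma>\<^sup>2"
    by simp
qed simp

text \<open>
  A point below the shift corresponds to the empty set of naturals, for which g = 0; any other point to
  a singleton. The second moment of \<Delta> is at most its supremum times its first absolute moment.
\<close>

lemma d_loc_bound:
  "d_loc (law M W) (TP \<mu> (\<sigma>\<^sup>2))
     \<le> 2 * sqrt (q_max M W * variance S) / (lam * \<sigma>\<^sup>2)
       + 2 * q_max M W * sqrt (variance R) / (lam * \<sigma>)
       + sqrt (variance R) / (lam * \<sigma>\<^sup>2) + 2 / \<sigma>\<^sup>2"
  unfolding d_loc_def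
proof (rule cSUP_least)
  fix z :: int
  define B where "B = {n. int n + shift \<in> {z}}"
  let ?q = "q_max M W" and ?i = "1 / \<sigma>\<^sup>2"
  let ?\<Delta> = "\<lambda>w. stein_W B (w + 1) - stein_W B w"
  define \<phi> where "\<phi> k = \<bar>stein_solution rate B (Suc k) - stein_solution rate B k\<bar>" for k
  have inv: "1 / rate \<le> ?i" using rate_ge sigma_pos by (simp add: frac_le)
  have i: "0 \<le> ?i" by simp
  have "B = {} \<or> B = {nat (z - shift)}" by (auto simp: B_def)
  hence *: "\<bar>stein_solution rate B n\<bar> \<le> ?i \<and> sum \<phi> {..<m} \<le> 2 * ?i" for n m
  proof
    assume "B = {}"
    hence "stein_solution rate B n = 0" for n by (simp add: stein_solution_def split: nat.split)
    thus ?thesis by (simp add: \<phi>_def)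
  next
    assume B: "B = {nat (z - shift)}"
    have "\<bar>stein_solution rate B n\<bar> \<le> ?i"
      unfolding B using abs_stein_singleton_le[OF rate_pos] inv order_trans by blast
    moreover have "sum \<phi> {..<m} \<le> 2 * ?i"
      using sum_abs_stein_singleton_diff_le[OF rate_pos, of "nat (z - shift)" m] inv
      by (simp add: \<phi>_def B)
    ultimately show ?thesis by blast
  qed
  have \<phi>_le: "\<phi> k \<le> ?i" for k
    unfolding \<phi>_def using abs_stein_diff_le[OF rate_pos, of B k] inv by linarith
  have abs_\<Delta>: "\<bar>?\<Delta> w\<bar> = (if shift \<le> w then \<phi> (nat (w - shift)) else 0)" for w
    by (simp add: stein_W_diff \<phi>_def)
  have "\<bar>expectation (\<lambda>\<omega>. ?\<Delta> (W \<omega>))\<bar> \<le> expectation (\<lambda>\<omega>. \<bar>?\<Delta> (W \<omega>)\<bar>)"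
    by (rule integral_abs_bound)
  also have "\<dots> \<le> ?q * (2 * ?i)"
    unfolding abs_\<Delta> using * by (intro expectation_le_q_max_sum) (auto simp: \<phi>_def)
  finally have a: "\<bar>expectation (\<lambda>\<omega>. ?\<Delta> (W \<omega>))\<bar> \<le> ?q * (2 * ?i)" .
  have sq_\<Delta>: "(?\<Delta> w)\<^sup>2 = (if shift \<le> w then (\<phi> (nat (w - shift)))\<^sup>2 else 0)" for w
    by (simp add: stein_W_diff \<phi>_def)
  have "(\<Sum>k<n. (\<phi> k)\<^sup>2) \<le> 2 * ?i\<^sup>2" for n
  proof -
    have "(\<Sum>k<n. (\<phi> k)\<^sup>2) \<le> (\<Sum>k<n. ?i * \<phi> k)"
      unfolding power2_eq_square[of "\<phi> _"]
      by (intro sum_mono mult_right_mono \<phi>_le) (simp add: \<phi>_def)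
    also have "\<dots> \<le> ?i * (2 * ?i)"
      unfolding sum_distrib_left[symmetric] using * i by (intro mult_left_mono) auto
    finally show ?thesis by (simp add: power2_eq_square)
  qed
  hence "expectation (\<lambda>\<omega>. (?\<Delta> (W \<omega>))\<^sup>2) \<le> ?q * (2 * ?i\<^sup>2)"
    unfolding sq_\<Delta> by (intro expectation_le_q_max_sum) auto
  also have "\<dots> \<le> (2 * sqrt ?q * ?i)\<^sup>2"
  proof -
    have "(2 * sqrt ?q * ?i)\<^sup>2 = ?q * (4 * ?i\<^sup>2)"
      using q_max_nonneg by (simp add: power_mult_distrib power_divide)
    thus ?thesis using q_max_nonneg by (simp add: mult_left_mono)
  qed
  finally have b: "sqrt (expectation (\<lambda>\<omega>. (?\<Delta> (W \<omega>))\<^sup>2)) \<le> 2 * sqrt ?q * ?i"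
    using q_max_nonneg by (intro real_le_lsqrt) auto
  have c: "\<bar>stein_solution rate B n\<bar> \<le> ?i" for n using * by blast
  have "(sqrt (variance S) * (2 * sqrt ?q * ?i) + \<sigma> * sqrt (variance R) * (?q * (2 * ?i)) + sqrt (variance R) * ?i) / lam
      = 2 * sqrt (?q * variance S) / (lam * \<sigma>\<^sup>2) + 2 * ?q * sqrt (variance R) / (lam * \<sigma>)
        + sqrt (variance R) / (lam * \<sigma>\<^sup>2)"
    using sigma_pos lam_pos by (simp add: field_simps power2_eq_square real_sqrt_mult)
  with abs_law_diff_TP_le[OF B_def c a b]
  show "\<bar>measure (law M W) {z} - measure (TP \<mu> (\<sigma>\<^sup>2)) {z}\<bar>
      \<le> 2 * sqrt (?q * variance S) / (lam * \<sigma>\<^sup>2) + 2 * ?q * sqrt (variance R) / (lam * \<sigma>)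
        + sqrt (variance R) / (lam * \<sigma>\<^sup>2) + 2 / \<sigma>\<^sup>2"
    by simp
qed simp

end

theorem theorem3p1:
  fixes M :: "'a measure" and W W' :: "'a \<Rightarrow> int" and R S :: "'a \<Rightarrow> real"
    and \<mu> \<sigma> lam :: real
  assumes "prob_space M"
    and "W \<in> measurable M (count_space UNIV)"
    and "W' \<in> measurable M (count_space UNIV)"
    and "R \<in> borel_measurable M"
    and "exchangeable M W W'"
    and "integrable M (\<lambda>\<omega>. real_of_int (W \<omega>))"
    and "prob_space.expectation M (\<lambda>\<omega>. real_of_int (W \<omega>)) = \<mu>"
    and "integrable M (\<lambda>\<omega>. (real_of_int (W \<omega>))\<^sup>2)"
    and "prob_space.variance M (\<lambda>\<omega>. real_of_int (W \<omega>)) = \<sigma>\<^sup>2"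
    and "0 < \<sigma>"
    and "0 < lam" and "lam < 1"
    and "AE \<omega> in M. cond_exp_given M W (\<lambda>\<omega>. real_of_int (W' \<omega>) - \<mu>) \<omega>
                     = (1 - lam) * (real_of_int (W \<omega>) - \<mu>) + R \<omega>"
    and "AE \<omega> in M. W' \<omega> - W \<omega> \<in> {-1, 0, 1}"
    and "S = cond_prob_given M W (\<lambda>\<omega>. W' \<omega> = W \<omega> + 1)"
  shows "d_TV (law M W) (TP \<mu> (\<sigma>\<^sup>2))
           \<le> sqrt (prob_space.variance M S) / (lam * \<sigma>\<^sup>2)
             + 2 * sqrt (prob_space.variance M R) / (lam * \<sigma>)
             + 2 / \<sigma>\<^sup>2 \<and>
         d_loc (law M W) (TP \<mu> (\<sigma>\<^sup>2))
           \<le> 2 * sqrt (q_max M W * prob_space.variance M S) / (lam * \<sigma>\<^sup>2)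
             + 2 * q_max M W * sqrt (prob_space.variance M R) / (lam * \<sigma>)
             + sqrt (prob_space.variance M R) / (lam * \<sigma>\<^sup>2)
             + 2 / \<sigma>\<^sup>2"
proof -
  interpret exchangeable_regression M W W' R \<mu> \<sigma> lam
    by (intro exchangeable_regression.intro exchangeable_regression_axioms.intro assms)
  show ?thesis
    unfolding \<open>S = _\<close> using d_TV_bound d_loc_bound by blast
qed

end
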